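(* Let $a>0$. The function $F_a$ has the integral representation $$F_a(z)=1+\frac{\ln\Gamma(1+1/a)}{z-1/a}-\int_0^\infty\frac{d_a(t)}{z+t}\,dt,\qquad z\in\mathcal A\setminus\{1/a\},$$ where $$d_a(t)=\frac{\ln|\Gamma(1-t)|+(k-1)\ln(at)}{t\left((\ln(at))^2+\pi^2\right)}\quad\text{for } t\in(k-1,k),\ k=1,2,\ldots,$$ and $d_a(0)=0$, $d_a(k)=\infty$ for $k=1,2,\ldots$. We have $d_a(t)\ge 0$ for all $t\ge 0$ whenever $a\ge 1/2$. Moreover $F_a$ is a Pick function for $a\ge 1$ but not for $0<a<1$.
   Context: $\mathcal A=\mathbb C\setminus(-\infty,0]$. $\operatorname{Log}$ is the principal logarithm on $\mathcal A$ (imaginary part in $(-\pi,\pi)$), $\ln$ is the natural logarithm of positive numbers, and $\log\Gamma(z)$ is the holomorphic branch of the logarithm of the Gamma function on $\mathcal A$ that equals $\ln\Gamma(x)$ for $x>0$. For $a>0$, $$F_a(z)=\frac{\log\Gamma(z+1)}{z\operatorname{Log}(az)},$$ holomorphic in $\mathcal A\setminus\{1/a\}$, with a simple pole at $z=1/a$ if $a\ne 1$ and a removable singularity at $z=1$ if $a=1$ (in which case $F_1$ denotes the function extended holomorphically to $\mathcal A$). A Pick function is a holomorphic function $\varphi$ on the upper half-plane $\mathbb H=\{z\in\mathbb C: \operatorname{Im} z>0\}$ with $\operatorname{Im}\varphi(z)\ge 0$ for all $z\in\mathbb H$; "$F_a$ is a Pick function" refers to the restriction of $F_a$ to $\mathbb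 H$. *)

theory Defs
  imports "HOL-Complex_Analysis.Complex_Analysis"
begin

abbreviation slit_plane :: "complex set" where
  "slit_plane \<equiv> - \<real>\<^sub>\<le>\<^sub>0"

text \<open>
  On complex numbers, \<^const>\<open>ln_Gamma\<close> is the branch of the logarithm of the Gamma function
  that is holomorphic off the nonpositive reals (\<open>holomorphic_ln_Gamma\<close>) and agrees with
  \<open>ln (Gamma x)\<close> for real \<open>x > 0\<close> (\<open>ln_Gamma_complex_of_real\<close>, \<open>ln_Gamma_real_pos\<close>);
  \<^const>\<open>Ln\<close> is the principal logarithm. For \<open>a = 1\<close> the singularity at \<open>1\<close> is removable and the
  value there is the limit. For \<open>a \<noteq> 1\<close> the value at the pole \<open>1/a\<close> is meaningless.
\<close>

definition F :: "real \<Rightarrow> complex \<Rightarrow> complex" where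
  "F a z = (if a = 1 \<and> z = 1
            then Lim (at 1) (\<lambda>w. ln_Gamma (w + 1) / (w * Ln w))
            else ln_Gamma (z + 1) / (z * Ln (of_real a * z)))"

text \<open>
  For \<open>k - 1 < t < k\<close> with \<open>k \<ge> 1\<close>, the integer \<open>k - 1\<close> is \<open>\<lfloor>t\<rfloor>\<close>. Only \<open>t \<ge> 0\<close> is meaningful.
\<close>

definition d :: "real \<Rightarrow> real \<Rightarrow> ereal" where
  "d a t = (if t = 0 then 0
            else if t \<in> \<int> then \<infinity>
            else ereal ((ln \<bar>Gamma (1 - t)\<bar> + of_int \<lfloor>t\<rfloor> * ln (a * t))
                        / (t * ((ln (a * t))\<^sup>2 + pi\<^sup>2))))"

definition pick_function :: "(complex \<Rightarrow> complex) \<Rightarrow> bool" where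
  "pick_function \<phi> \<longleftrightarrow>
     \<phi> holomorphic_on {z. Im z > 0} \<and> (\<forall>z. Im z > 0 \<longrightarrow> Im (\<phi> z) \<ge> 0)"

text \<open>
  The points where \<^const>\<open>d\<close> is infinite form a null set, so
  it does not matter that \<^const>\<open>real_of_ereal\<close> maps \<open>\<infinity>\<close> to \<open>0\<close>.
\<close>

abbreviation F_integrand :: "real \<Rightarrow> complex \<Rightarrow> real \<Rightarrow> complex" where
  "F_integrand a z t \<equiv> of_real (real_of_ereal (d a t)) / (z + of_real t)"

end

theory Submission
  imports Defs
begin

text \<open>
  Substitute \<open>z = exp w\<close>, which maps the strip \<open>\<bar>Im w\<bar> < pi\<close> onto the slit plane and turns
  \<open>Log (a z)\<close> into \<open>w + ln a\<close>. The residue theorem on the rectangle \<open>\<bar>Re w\<bar> \<le> R\<close>,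
  \<open>\<bar>Im w\<bar> \<le> \<theta>\<close>, applied to the Cauchy kernel of \<open>F\<^sub>a\<close>, collects \<open>F\<^sub>a z\<close> and the pole at
  \<open>1/a\<close>. As \<open>\<theta> \<rightarrow> pi\<close> the horizontal sides converge to the integral of the jump of \<open>F\<^sub>a\<close>
  across the cut, which is the density \<open>d\<^sub>a\<close>. The vertical sides do not vanish, but their
  difference for two points \<open>z\<close>, \<open>z'\<close> does: that kernel decays like \<open>1/\<zeta>\<^sup>2\<close>, so a crude
  quadratic bound for \<open>log \<Gamma>\<close> on the circles \<open>\<bar>\<zeta>\<bar> = n + 1/2\<close> suffices. Hence \<open>F\<^sub>a\<close> minus its
  pole plus the integral is constant, and letting \<open>z\<close> run through the integers shows that the
  constant is \<open>1\<close>.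
\<close>

section \<open>The density\<close>

text \<open>\<open>F a\<close> tends to 1 along the positive axis, so a Cauchy integral for a single
  point keeps its outer side. In the difference for two points the factor of order
  \<open>1/\<zeta>^2\<close> only balances the quadratic bound for log Gamma; what makes the sides
  vanish is the factor \<open>1 / Log (a \<zeta>)\<close>, of size \<open>1/R\<close> in the strip.
  The side near the origin dies by the same \<open>1/R\<close>, since log Gamma is bounded there.
  The obstacle is that log Gamma is singular at -1, -2, ..., on the cut itself. These singularities
  are logarithmic and are treated throughout by \<open>- ln u \<le> 2 / sqrt u\<close>: the right
  side is integrable, with an explicit antiderivative. This yields the integrability of the density,
  the majorant for the limit onto the cut, and the growth on circles. Branches are tracked by moving
  the argument to the right with the functional equation, which leaves finitely many principal
  logarithms. Each one whose argument ends on the negative axis contributes \<open>\<i> * pi\<close>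
  up to sign; their number is the floor of \<open>t\<close>, the origin of the term
  \<open>(k - 1) * ln (a * t)\<close> in the density.\<close>

lemma ln_abs_Gamma_one_minus:
  fixes t :: real
  assumes t: "t \<notin> \<int>" and M: "t < real M + 1"
  shows "ln \<bar>Gamma (1 - t)\<bar> = ln (Gamma (real M + 1 - t)) - (\<Sum>i<M. ln \<bar>t - real (Suc i)\<bar>)"
proof -
  have nz: "t - real (Suc i) \<noteq> 0" for i
    using t by (metis Ints_of_nat eq_iff_diff_eq_0)
  have ni: "1 - t \<notin> \<int>\<^sub>\<le>\<^sub>0"
    using t by (metis Ints_1 Ints_diff diff_diff_eq2 diff_add_cancel add_diff_cancel_left' nonpos_Ints_Int)
  have "pochhammer (1 - t) M = Gamma (1 - t + real M) / Gamma (1 - t)"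
    using pochhammer_Gamma[OF ni] .
  moreover have "real M + 1 - t \<notin> \<int>\<^sub>\<le>\<^sub>0" using nonpos_Ints_nonpos[of "real M + 1 - t"] M by auto
  hence "Gamma (real M + 1 - t) \<noteq> 0" "Gamma (1 - t) \<noteq> 0" using ni Gamma_eq_zero_iff by blast+
  moreover have "1 - t + real M = real M + 1 - t" by simp
  ultimately have "Gamma (1 - t) = Gamma (real M + 1 - t) / pochhammer (1 - t) M"
    by (metis divide_divide_eq_right nonzero_mult_div_cancel_left)
  hence "\<bar>Gamma (1 - t)\<bar> = \<bar>Gamma (real M + 1 - t)\<bar> / \<bar>pochhammer (1 - t) M\<bar>"
    by (simp only: abs_divide)
  also have "\<bar>pochhammer (1 - t) M\<bar> = (\<Prod>i<M. \<bar>t - real (Suc i)\<bar>)"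
    unfolding pochhammer_prod abs_prod atLeast0LessThan
    by (intro prod.cong refl) (simp add: abs_minus_commute algebra_simps)
  also have "\<bar>Gamma (real M + 1 - t)\<bar> = Gamma (real M + 1 - t)" using M by simp
  finally have "ln \<bar>Gamma (1 - t)\<bar> = ln (Gamma (real M + 1 - t) / (\<Prod>i<M. \<bar>t - real (Suc i)\<bar>))"
    by (rule arg_cong)
  also have "\<dots> = ln (Gamma (real M + 1 - t)) - ln (\<Prod>i<M. \<bar>t - real (Suc i)\<bar>)"
    by (intro ln_divide_pos Gamma_real_pos prod_pos) (use nz M in auto)
  also have "ln (\<Prod>i<M. \<bar>t - real (Suc i)\<bar>) = (\<Sum>i<M. ln \<bar>t - real (Suc i)\<bar>)"
    by (intro ln_prod) (use nz in auto)
  finally show ?thesis .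
qed

lemma floor_eq_nat: "real m < t \<Longrightarrow> t < real m + 1 \<Longrightarrow> \<lfloor>t\<rfloor> = int m"
  by (simp add: floor_eq_iff)

lemma not_Int_between: "real m < t \<Longrightarrow> t < real m + 1 \<Longrightarrow> t \<notin> \<int>"
  by (smt (verit, best) Ints_cases floor_eq_nat floor_of_int of_int_of_nat_eq)

section \<open>Convexity bounds for the logarithm of Gamma near 1, square-root bounds for the
  logarithm\<close>

lemma ln_Gamma_le_chord:
  fixes x y u :: real
  assumes "x > 0" "y > 0" "0 \<le> u" "u \<le> 1"
  shows "ln (Gamma ((1 - u) * x + u * y)) \<le> (1 - u) * ln (Gamma x) + u * ln (Gamma y)"
  using convex_onD[OF log_convex_Gamma_real, of u x y] assms by auto

text \<open>A convex function that vanishes at 1 and 2 cannot be negative to the left of 1.\<close>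

lemma ln_Gamma_one_minus_nonneg:
  assumes "0 \<le> s" "s < (1::real)"
  shows "ln (Gamma (1 - s)) \<ge> 0"
proof -
  \<comment> \<open>The weight that makes 1 a convex combination of \<open>1 - s\<close> and
    2.\<close>
  define u where "u = s / (1 + s)"
  have u: "0 \<le> u" "u < 1" using assms by (auto simp: u_def)
  have "1 - u = 1 / (1 + s)" using assms by (simp add: u_def field_simps)
  hence "(1 - u) * (1 - s) + u * 2 = (1 - s) / (1 + s) + 2 * s / (1 + s)" by (simp add: u_def)
  also have "\<dots> = 1" using assms by (simp flip: add_divide_distrib)
  finally have "(1 - u) * (1 - s) + u * 2 = 1" .
  hence "0 \<le> (1 - u) * ln (Gamma (1 - s))"
    using ln_Gamma_le_chord[of "1 - s" 2 u] u assms by (simp add: Gamma_numeral)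
  thus ?thesis using u by (simp add: zero_le_mult_iff)
qed

text \<open>The chord over [1, 2] is zero. Besides the growth bounds, this supplies the sign of the
  pole coefficient \<open>ln (Gamma (1 + 1 / a))\<close> for \<open>a \<ge> 1\<close>.\<close>

lemma ln_Gamma_between_1_2:
  assumes "1 \<le> x" "x \<le> (2::real)"
  shows "ln (Gamma x) \<le> 0"
  using ln_Gamma_le_chord[of 1 2 "x - 1"] assms by (simp add: Gamma_numeral algebra_simps)

text \<open>One use of the functional equation moves the argument to \<open>2 - s\<close> in (1, 2],
  where the logarithm of Gamma is nonpositive; only the factor \<open>1 - s\<close> remains.\<close>

lemma ln_Gamma_one_minus_le:
  assumes "0 \<le> s" "s < (1::real)"
  shows "ln (Gamma (1 - s)) \<le> - ln (1 - s)"
proof -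
  have "Gamma (2 - s) = (1 - s) * Gamma (1 - s)"
    using assms Gamma_plus1[of "1 - s"] nonpos_Ints_nonpos[of "1 - s"] by (auto simp: algebra_simps)
  moreover have "Gamma (1 - s) > 0" using assms by simp
  ultimately show ?thesis
    using ln_Gamma_between_1_2[of "2 - s"] assms by (simp add: ln_mult_pos)
qed

text \<open>The factor \<open>1 - u\<close> is kept so that the bound vanishes at
  \<open>u = 1\<close>: with \<open>u = 1 - t\<close> it gives a numerator of order \<open>t\<close>
  near 0, which absorbs the \<open>t\<close> in the denominator of the density.\<close>

lemma minus_ln_le_sqrt:
  assumes "0 < u" "u \<le> (1::real)"
  shows "- ln u \<le> 2 * (1 - u) / sqrt u"
proof -
  \<comment> \<open>Applying \<open>ln x \<le> x - 1\<close> to \<open>1 / v\<close> instead of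
    \<open>1 / u\<close> leaves the integrable singularity \<open>1 / sqrt u\<close>.\<close>
  define v where "v = sqrt u"
  have v: "0 < v" "v \<le> 1" "u = v\<^sup>2" using assms by (auto simp: v_def)
  have "- ln v = ln (1 / v)" using v by (simp add: ln_div)
  also have "\<dots> \<le> 1 / v - 1" using v ln_le_minus_one[of "1/v"] by simp
  also have "\<dots> \<le> (1 - v) * (1 + v) / v" using v by (simp add: field_simps)
  finally have "- (2 * ln v) \<le> 2 * ((1 - v) * (1 + v) / v)" by simp
  also have "\<dots> = 2 * (1 - u) / v" using v by (simp add: power2_eq_square algebra_simps)
  also have "2 * ln v = ln u" using v by (simp add: ln_realpow)
  finally show ?thesis by (simp add: v_def)
qed

lemma minus_ln_le_sqrt':
  assumes "0 < u"
  shows "- ln u \<le> 2 / sqrt (u::real)"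
proof (cases "u \<le> 1")
  case True
  have "2 * (1 - u) / sqrt u \<le> 2 / sqrt u"
    using assms by (intro divide_right_mono) auto
  thus ?thesis using minus_ln_le_sqrt[OF assms True] by linarith
next
  case False
  have "0 \<le> 2 / sqrt u" using assms by simp
  moreover have "ln u \<ge> 0" using False by simp
  ultimately show ?thesis by linarith
qed

section \<open>The numerator of the density: sign and growth\<close>

definition d_num :: "real \<Rightarrow> real \<Rightarrow> real" where
  "d_num a t = ln \<bar>Gamma (1 - t)\<bar> + of_int \<lfloor>t\<rfloor> * ln (a * t)"

text \<open>The functional equation produces \<open>m\<close> factors \<open>t - j\<close>, and the
  floor of \<open>t\<close> provides exactly \<open>m\<close> copies of \<open>ln (a * t)\<close>,
  one for each factor. What is left is Gamma at one minus the fractional part, whose logarithm is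
  nonnegative.\<close>

lemma d_num_eq:
  assumes "real m < t" "t < real m + 1" "a > 0"
  shows "d_num a t = ln (Gamma (1 - (t - real m))) + (\<Sum>i<m. ln (a * t / (t - real (Suc i))))"
proof -
  have pos: "t - real (Suc i) > 0" if "i < m" for i using that assms by auto
  have "t > 0" using assms by linarith
  have *: "(\<Sum>i<m. ln (a * t / (t - real (Suc i)))) = (\<Sum>i<m. ln (a * t) - ln (t - real (Suc i)))"
    using pos assms \<open>t > 0\<close> by (intro sum.cong refl) (simp add: ln_div)
  have "ln \<bar>Gamma (1 - t)\<bar> = ln (Gamma (real m + 1 - t)) - (\<Sum>i<m. ln \<bar>t - real (Suc i)\<bar>)"
    using assms not_Int_between by (intro ln_abs_Gamma_one_minus) auto
  also have "(\<Sum>i<m. ln \<bar>t - real (Suc i)\<bar>) = (\<Sum>i<m. ln (t - real (Suc i)))"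
    using pos by (intro sum.cong refl) (simp add: less_imp_le)
  finally show ?thesis
    unfolding d_num_def floor_eq_nat[OF assms(1,2)] * sum_subtractf by (simp add: algebra_simps)
qed

text \<open>Reduces the size estimates to \<open>a = 1\<close>, at the cost of a term that grows at
  most linearly in \<open>t\<close>.\<close>

lemma d_num_scale:
  assumes "t > 0" "a > 0"
  shows "d_num a t = d_num 1 t + of_int \<lfloor>t\<rfloor> * ln a"
  using assms by (simp add: d_num_def ln_mult algebra_simps)

lemma d_num_nonneg:
  assumes "real m < t" "t < real m + 1" "a \<ge> 1 / 2"
  shows "d_num a t \<ge> 0"
proof -
  have a: "a > 0" using assms by simp
  have t: "t > 0" using assms by linarith
  define f where "f i = ln (a * t / (t - real (Suc i)))" for i
  have pos: "t - real (Suc i) > 0" if "i < m" for i using that assms by auto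
  \<comment> \<open>Pair the factors \<open>t - j\<close> and \<open>t - (k - j)\<close>, where \<open>k = m + 1\<close>: by AM-GM their product is at
    most \<open>(t/2)\<^sup>2\<close>. This is where the threshold \<open>a = 1/2\<close> comes from.\<close>
  have pair: "f i + f (m - Suc i) \<ge> 0" if "i < m" for i
  proof -
    have i': "m - Suc i < m" using that by simp
    define x where "x = t - real (Suc i)"
    define y where "y = t - real (Suc (m - Suc i))"
    have xy: "x > 0" "y > 0" using pos[OF that] pos[OF i'] by (simp_all add: x_def y_def)
    have "x + y = 2 * t - real m - 1" using that by (simp add: x_def y_def of_nat_diff)
    hence "x + y \<le> t" "x + y \<ge> 0" using assms xy by auto
    have "x * y \<le> ((x + y) / 2)\<^sup>2"
    proof -
      have "((x + y) / 2)\<^sup>2 - x * y = ((x - y) / 2)\<^sup>2" by (simp add: power2_eq_square field_simps)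
      thus ?thesis by (smt (verit) zero_le_power2)
    qed
    also have "\<dots> \<le> (t / 2)\<^sup>2" using \<open>x + y \<le> t\<close> \<open>x + y \<ge> 0\<close> by (intro power_mono) auto
    also have "\<dots> \<le> (a * t)\<^sup>2" using assms(3) t by (intro power_mono) auto
    finally have "1 \<le> (a * t / x) * (a * t / y)" using xy by (simp add: field_simps power2_eq_square)
    hence "0 \<le> ln ((a * t / x) * (a * t / y))" by simp
    also have "\<dots> = ln (a * t / x) + ln (a * t / y)" using xy a t by (intro ln_mult_pos) auto
    finally show ?thesis by (simp add: f_def x_def y_def)
  qed
  have "2 * sum f {..<m} = sum f {..<m} + (\<Sum>i<m. f (m - Suc i))"
    by (simp add: sum.nat_diff_reindex)
  also have "\<dots> = (\<Sum>i<m. f i + f (m - Suc i))" by (simp add: sum.distrib)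
  also have "\<dots> \<ge> 0" by (intro sum_nonneg pair) auto
  finally have "sum f {..<m} \<ge> 0" by simp
  moreover have "ln (Gamma (1 - (t - real m))) \<ge> 0"
    using assms by (intro ln_Gamma_one_minus_nonneg) auto
  ultimately show ?thesis using d_num_eq[OF assms(1,2) a] by (simp add: f_def)
qed

lemma d_num_le_first:
  assumes "0 < t" "t < 1"
  shows "d_num 1 t \<le> 2 * t / sqrt (1 - t)"
proof -
  have "d_num 1 t = ln (Gamma (1 - t))" using d_num_eq[of 0 t 1] assms by simp
  thus ?thesis
    using ln_Gamma_one_minus_le[of t] minus_ln_le_sqrt[of "1 - t"] assms by simp
qed

text \<open>In reversed order the denominators of \<open>d_num_eq\<close> are \<open>s + i\<close>
  with \<open>i < m\<close>. The term \<open>i = 0\<close> carries the singularity at the left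
  endpoint; the product of the others is at most \<open>(m + 1)^(m - 1) / (m - 1)!\<close>, so its
  logarithm grows linearly. The singularity at the right endpoint comes from
  \<open>Gamma (1 - s)\<close>.\<close>

lemma d_num_le_later:
  assumes "real m < t" "t < real m + 1" "m \<ge> 1"
  shows "d_num 1 t \<le> 1 + 2 * t + 2 / sqrt (t - real m) + 2 / sqrt (1 - (t - real m))"
proof -
  define s where "s = t - real m"
  have s: "0 < s" "s < 1" using assms by (auto simp: s_def)
  have t: "t > 0" using assms by linarith
  obtain n where n: "m = Suc n" using assms by (cases m) auto
  \<comment> \<open>\<open>A\<close> is one term of the exponential series at \<open>m + 1\<close>,
    hence at most \<open>exp (m + 1)\<close>; \<open>B\<close> is the product bounding the regular
    factors. In \<open>(m + 1) * B = m * A\<close> the extra \<open>m + 1\<close> pays for the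
    numerator \<open>t\<close> of the singular factor.\<close>
  define A where "A = (real m + 1) ^ m / fact m"
  define B where "B = (real m + 1) ^ n / fact n"
  have A: "A > 0" "A \<le> exp (real m + 1)"
    using sum_le_suminf[OF summable_exp_generic[of "real m + 1"], of "{m}"]
    by (simp_all add: A_def exp_def scaleR_conv_of_real divide_inverse mult_ac)
  have B: "B > 0" by (simp add: B_def)
  have AB: "(real m + 1) * B = real m * A" using n by (simp add: A_def B_def)
  have tail: "ln (t / (s + real (Suc i))) \<le> ln ((real m + 1) / real (Suc i))" for i
  proof -
    have "t / (s + real (Suc i)) \<le> (real m + 1) / real (Suc i)"
      using s assms t by (intro frac_le) auto
    moreover have "t / (s + real (Suc i)) > 0" using s t by (intro divide_pos_pos) auto
    ultimately show ?thesis by (intro ln_mono)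
  qed
  have "(\<Sum>i<n. ln ((real m + 1) / real (Suc i))) = ln (\<Prod>i<n. (real m + 1) / real (Suc i))"
    by (intro ln_prod[symmetric]) auto
  moreover have "(\<Prod>i<n. (real m + 1) / real (Suc i)) = B"
    by (simp add: B_def prod_dividef fact_prod_Suc atLeast0LessThan)
  ultimately have prod_eq: "(\<Sum>i<n. ln ((real m + 1) / real (Suc i))) = ln B" by simp
  have "ln (real m + 1) + ln B = ln (real m) + ln A"
    using ln_mult_pos[of "real m + 1" B] ln_mult_pos[of "real m" A] A B n unfolding AB by simp
  moreover have "ln A \<le> real m + 1" using A ln_mono[of A "exp (real m + 1)"] by (simp only: ln_exp)
  moreover have "ln (real m) \<le> real m - 1" using n ln_le_minus_one[of "real m"] by simp
  ultimately have ln_B: "ln (real m + 1) + ln B \<le> 2 * t" using assms by linarith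

  have "(\<Sum>i<m. ln (1 * t / (t - real (Suc i)))) = (\<Sum>i<m. ln (t / (t - real (Suc (m - Suc i)))))"
    using sum.nat_diff_reindex[of "\<lambda>i. ln (t / (t - real (Suc i)))" m] by simp
  also have "\<dots> = (\<Sum>i<m. ln (t / (s + real i)))"
    by (intro sum.cong refl) (auto simp: s_def of_nat_diff algebra_simps)
  also have "\<dots> = ln (t / s) + (\<Sum>i<n. ln (t / (s + real (Suc i))))"
    by (simp add: n sum.lessThan_Suc_shift del: of_nat_Suc sum.lessThan_Suc)
  also have "\<dots> \<le> (ln (real m + 1) - ln s) + (\<Sum>i<n. ln ((real m + 1) / real (Suc i)))"
    by (intro add_mono sum_mono tail) (use s t assms in \<open>simp add: ln_div\<close>)
  also have "\<dots> \<le> 2 * t - ln s" using ln_B unfolding prod_eq by simp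
  finally have "(\<Sum>i<m. ln (1 * t / (t - real (Suc i)))) \<le> 2 * t - ln s" .
  moreover have "ln (Gamma (1 - s)) \<le> - ln (1 - s)"
    using s by (intro ln_Gamma_one_minus_le) auto
  moreover have "- ln s \<le> 2 / sqrt s" "- ln (1 - s) \<le> 2 / sqrt (1 - s)"
    using s by (intro minus_ln_le_sqrt'; simp)+
  moreover have "d_num 1 t = ln (Gamma (1 - s)) + (\<Sum>i<m. ln (1 * t / (t - real (Suc i))))"
    using d_num_eq[OF assms(1,2), of 1] by (simp add: s_def)
  ultimately show ?thesis unfolding s_def by linarith
qed

lemma d_eq_d_num:
  assumes "t \<notin> \<int>"
  shows "d a t = ereal (d_num a t / (t * ((ln (a * t))\<^sup>2 + pi\<^sup>2)))"
  using assms by (auto simp: d_def d_num_def)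

lemma obtain_unit_interval:
  assumes "t \<ge> 0" "t \<notin> \<int>"
  obtains m where "real m < t" "t < real m + 1"
proof
  have "t \<noteq> of_int \<lfloor>t\<rfloor>" using assms by (metis Ints_of_int)
  moreover have "\<lfloor>t\<rfloor> \<ge> 0" using assms by simp
  ultimately show "real (nat \<lfloor>t\<rfloor>) < t" "t < real (nat \<lfloor>t\<rfloor>) + 1"
    by linarith+
qed

lemma d_nonneg:
  assumes "a \<ge> 1 / 2" "t \<ge> 0"
  shows "d a t \<ge> 0"
proof (cases "t \<in> \<int>")
  case True
  thus ?thesis by (simp add: d_def)
next
  case False
  then obtain m where "real m < t" "t < real m + 1" using assms obtain_unit_interval by blast
  hence "d_num a t \<ge> 0" using assms(1) d_num_nonneg by blast
  thus ?thesis using False assms by (simp add: d_eq_d_num)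
qed

section \<open>Integrability of the density\<close>

abbreviation dr :: "real \<Rightarrow> real \<Rightarrow> real" where
  "dr a t \<equiv> real_of_ereal (d a t)"

text \<open>\<open>rGamma\<close> is continuous everywhere, and \<open>inverse\<close> recovers
  \<open>Gamma\<close> from it even at the poles, where both conventions give 0.\<close>

lemma dr_measurable [measurable]: "dr a \<in> borel_measurable borel"
proof -
  have "(\<lambda>t::real. inverse (rGamma (1 - t))) \<in> borel_measurable borel"
    by (intro borel_measurable_inverse borel_measurable_continuous_onI
          continuous_on_compose2[OF continuous_on_rGamma[of UNIV]] continuous_intros) auto
  hence [measurable]: "(\<lambda>t::real. Gamma (1 - t)) \<in> borel_measurable borel"
    by (simp add: rGamma_inverse_Gamma)
  have [measurable]: "(\<int> :: real set) \<in> sets borel"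
    by (intro countable_imp_null_set_lborel[THEN null_setsD2, simplified] countable_int)
  show ?thesis unfolding d_def by measurable
qed

lemma dr_eq: "t \<notin> \<int> \<Longrightarrow> dr a t = d_num a t / (t * ((ln (a * t))\<^sup>2 + pi\<^sup>2))"
  by (simp add: d_eq_d_num)

text \<open>The squared logarithm rescues the divergent \<open>1 / t\<close> at both ends: in the
  variable \<open>x = ln (a * t)\<close> the integrand is \<open>1 / (x^2 + pi^2)\<close>.\<close>

lemma set_integrable_inverse_ln_squared:
  assumes "a > 0"
  shows "set_integrable lborel {0<..} (\<lambda>t. 1 / (t * ((ln (a * t))\<^sup>2 + pi\<^sup>2)))"
proof -
  have "set_integrable lborel (einterval 0 \<infinity>) (\<lambda>t. 1 / (t * ((ln (a * t))\<^sup>2 + pi\<^sup>2)))"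
  proof (rule interval_integral_FTC_nonneg(1)[where F = "\<lambda>t. arctan (ln (a * t) / pi) / pi"])
    fix t :: real assume "0 < ereal t"
    hence t: "t > 0" by simp
    have *: "(ln (a * t))\<^sup>2 + pi\<^sup>2 > 0"
      by (intro add_nonneg_pos) auto
    have "pi * (1 + (ln (a * t) / pi)\<^sup>2) * (pi * t) = t * ((ln (a * t))\<^sup>2 + pi\<^sup>2)"
      by (simp add: field_simps power2_eq_square)
    thus "DERIV (\<lambda>t. arctan (ln (a * t) / pi) / pi) t :> 1 / (t * ((ln (a * t))\<^sup>2 + pi\<^sup>2))"
      using t assms
      by (auto intro!: derivative_eq_intros simp: divide_simps mult_ac)
    show "isCont (\<lambda>t. 1 / (t * ((ln (a * t))\<^sup>2 + pi\<^sup>2))) t"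
      using t assms * by (intro continuous_intros) auto
  next
    show "AE x in lborel. 0 < ereal x \<longrightarrow> ereal x < \<infinity> \<longrightarrow> 0 \<le> 1 / (x * ((ln (a * x))\<^sup>2 + pi\<^sup>2))"
      by (intro AE_I2) (auto intro!: divide_nonneg_nonneg mult_nonneg_nonneg add_nonneg_nonneg)
    have "((\<lambda>t. arctan (ln (a * t) / pi) / pi) \<longlongrightarrow> (- (pi / 2)) / pi) (at_right 0)"
    proof (intro tendsto_divide filterlim_compose[OF tendsto_arctan_at_bot] tendsto_const)
      show "filterlim (\<lambda>t. ln (a * t) / pi) at_bot (at_right 0)"
        using assms by real_asymp
    qed simp
    thus "(((\<lambda>t. arctan (ln (a * t) / pi) / pi) \<circ> real_of_ereal) \<longlongrightarrow> (- (pi / 2)) / pi) (at_right 0)"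
      by (simp add: ereal_tendsto_simps zero_ereal_def)
    have "((\<lambda>t. arctan (ln (a * t) / pi) / pi) \<longlongrightarrow> (pi / 2) / pi) at_top"
    proof (intro tendsto_divide filterlim_compose[OF tendsto_arctan_at_top] tendsto_const)
      show "filterlim (\<lambda>t. ln (a * t) / pi) at_top at_top"
        using assms by real_asymp
    qed simp
    thus "(((\<lambda>t. arctan (ln (a * t) / pi) / pi) \<circ> real_of_ereal) \<longlongrightarrow> (pi / 2) / pi) (at_left \<infinity>)"
      by (simp add: ereal_tendsto_simps)
  qed auto
  also have "einterval 0 \<infinity> = {0<..}" by (auto simp: einterval_def)
  finally show ?thesis .
qed

text \<open>The value is the same for every unit interval, so weights \<open>1 / (1 + m)^2\<close>
  make the sum over all intervals converge.\<close>

lemma inverse_sqrt_integral: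
  fixes m :: real
  defines "f \<equiv> (\<lambda>t. 1 / sqrt (t - m) + 1 / sqrt (m + 1 - t))"
  shows "set_integrable lborel {m<..<m+1} f"
    and "(LBINT t:{m<..<m+1}. f t) = 4"
proof -
  have lt: "ereal m < ereal (m + 1)" by simp
  have 1: "DERIV (\<lambda>t. 2 * sqrt (t - m) - 2 * sqrt (m + 1 - t)) t :> f t"
    if "ereal m < ereal t" "ereal t < ereal (m + 1)" for t
    using that unfolding f_def by (auto intro!: derivative_eq_intros simp: field_simps)
  have 2: "isCont f t" if "ereal m < ereal t" "ereal t < ereal (m + 1)" for t
    using that unfolding f_def by (intro continuous_intros) auto
  have 3: "AE x in lborel. ereal m < ereal x \<longrightarrow> ereal x < ereal (m + 1) \<longrightarrow> 0 \<le> f x"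
    by (intro AE_I2) (auto simp: f_def)
  have 4: "(((\<lambda>t. 2 * sqrt (t - m) - 2 * sqrt (m + 1 - t)) \<circ> real_of_ereal) \<longlongrightarrow> - 2) (at_right (ereal m))"
    unfolding ereal_tendsto_simps by (auto intro!: tendsto_eq_intros)
  have 5: "(((\<lambda>t. 2 * sqrt (t - m) - 2 * sqrt (m + 1 - t)) \<circ> real_of_ereal) \<longlongrightarrow> 2) (at_left (ereal (m + 1)))"
    unfolding ereal_tendsto_simps by (auto intro!: tendsto_eq_intros)
  note FTC = interval_integral_FTC_nonneg[OF lt 1 2 3 4 5]
  have e: "einterval (ereal m) (ereal (m + 1)) = {m<..<m+1}" by (auto simp: einterval_def)
  show "set_integrable lborel {m<..<m+1} f" using FTC(1) by (simp add: e)
  show "(LBINT t:{m<..<m+1}. f t) = 4"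
    using FTC(2) by (simp add: interval_lebesgue_integral_def e)
qed

lemma set_integrable_dr:
  assumes "a > 0"
  shows "set_integrable lborel {0..} (\<lambda>t. dr a t / (1 + t))"
proof -
  define p :: "nat \<Rightarrow> real \<Rightarrow> real"
    where "p m t = 1 / sqrt (t - real m) + 1 / sqrt (real m + 1 - t)" for m t
  define f :: "nat \<Rightarrow> real \<Rightarrow> real"
    where "f m t = indicator {real m<..<real m + 1} t * p m t / (1 + real m)\<^sup>2" for m t
  define W where "W t = (ln (a * t))\<^sup>2 + pi\<^sup>2" for t
  \<comment> \<open>\<open>3 + \<bar>ln a\<bar>\<close> is the coefficient of \<open>1 + t\<close>
    in a bound for \<open>1 + 2 * t + k * \<bar>ln a\<bar>\<close>; the 4 is the 2 of the
    square-root terms divided by the 1/2 in \<open>(1 + k)^2 / 2\<close> below.\<close>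
  define g where "g t = (3 + \<bar>ln a\<bar>) * (indicator {0<..} t * (1 / (t * W t))) + 4 * (\<Sum>m. f m t)" for t
  have W: "W t \<ge> 1" for t
  proof -
    have "1 ^ 2 \<le> pi\<^sup>2" using pi_gt3 by (intro power_mono) auto
    thus ?thesis unfolding W_def by (smt (verit) one_power2 zero_le_power2)
  qed
  have W0: "W t > 0" for t using W[of t] by linarith
  have f_0: "f m t = 0" if "real k < t" "t < real k + 1" "m \<noteq> k" for k m t
  proof -
    have "\<not> (real m < t \<and> t < real m + 1)"
      using floor_eq_nat[of m t] floor_eq_nat[of k t] that by auto
    thus ?thesis by (auto simp: f_def)
  qed
  have f_nonneg: "f m t \<ge> 0" for m t
    by (auto simp: f_def p_def indicator_def)
  have int_f: "integrable lborel (f m)" "integral\<^sup>L lborel (\<lambda>t. norm (f m t)) = 4 / (1 + real m)\<^sup>2" for m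
  proof -
    show "integrable lborel (f m)"
      using inverse_sqrt_integral(1)[of "real m"]
      unfolding f_def p_def set_integrable_def by (simp add: algebra_simps)
    have "integral\<^sup>L lborel (f m) = 4 / (1 + real m)\<^sup>2"
      using inverse_sqrt_integral(2)[of "real m"]
      unfolding f_def p_def set_lebesgue_integral_def by (simp add: algebra_simps)
    thus "integral\<^sup>L lborel (\<lambda>t. norm (f m t)) = 4 / (1 + real m)\<^sup>2"
      using f_nonneg by simp
  qed
  have AE_Int: "AE t in lborel. t \<notin> (\<int> :: real set)"
    by (intro AE_not_in countable_imp_null_set_lborel countable_int)
  have AE_neg: "AE t in lborel. t \<notin> (\<int> :: real set) \<and> (t < 0 \<or> (\<exists>k. real k < t \<and> t < real k + 1))"
    using AE_Int by eventually_elim (meson not_less obtain_unit_interval)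
  have f_neg: "f m t = 0" if "t < 0" for m t using that by (auto simp: f_def)
  have "integrable lborel (\<lambda>t. \<Sum>m. f m t)"
  proof (rule integrable_suminf)
    show "AE t in lborel. summable (\<lambda>m. norm (f m t))"
      using AE_neg
    proof eventually_elim
      case (elim t)
      thus ?case
      proof (elim conjE disjE exE)
        fix k assume "real k < t" "t < real k + 1"
        thus ?thesis using f_0[of k t] by (intro summable_finite[of "{k}"]) auto
      qed (simp add: f_neg)
    qed
    have "summable (\<lambda>m. 4 * (1 / (real m + 1)\<^sup>2))"
      using inverse_squares_sums by (intro summable_mult) (auto simp: sums_iff add_ac)
    thus "summable (\<lambda>m. integral\<^sup>L lborel (\<lambda>t. norm (f m t)))"
      unfolding int_f by (simp add: add_ac)
  qed (rule int_f)
  moreover have "integrable lborel (\<lambda>t. indicator {0<..} t * (1 / (t * W t)))"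
    using set_integrable_inverse_ln_squared[OF assms] by (simp add: set_integrable_def W_def)
  ultimately have g: "integrable lborel g" unfolding g_def by (intro Bochner_Integration.integrable_add integrable_mult_right)
  \<comment> \<open>The part of the numerator linear in \<open>t\<close> is absorbed by \<open>1 / (t W)\<close>, with antiderivative
    \<open>arctan\<close>; the singularities at the integers only need \<open>W \<ge> 1\<close> and leave \<open>1/m\<^sup>2\<close> to spare.\<close>
  have bound: "AE t in lborel. norm (indicat_real {0..} t *\<^sub>R (dr a t / (1 + t))) \<le> norm (g t)"
    using AE_neg
  proof eventually_elim
    case (elim t)
    have "indicat_real {0..} t *\<^sub>R \<bar>dr a t / (1 + t)\<bar> \<le> g t"
    proof (cases "t < 0")
      case False
      with elim obtain k where k: "real k < t" "t < real k + 1" by auto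
      have t: "t > 0" using k by linarith
      have sum_f: "(\<Sum>m. f m t) = p k t / (1 + real k)\<^sup>2"
      proof -
        have "(\<Sum>m. f m t) = (\<Sum>m\<in>{k}. f m t)"
          using f_0[OF k] by (intro suminf_finite) auto
        thus ?thesis using k by (simp add: f_def)
      qed
      have p: "p k t \<ge> 0" using k by (simp add: p_def)
      have dr: "\<bar>dr a t / (1 + t)\<bar> = \<bar>d_num a t\<bar> / (t * W t * (1 + t))"
        using elim t W0[of t] by (simp add: dr_eq W_def[symmetric] abs_mult)
      have d_num_a: "\<bar>d_num a t\<bar> \<le> d_num 1 t + real k * \<bar>ln a\<bar>"
      proof -
        have "d_num a t = d_num 1 t + real k * ln a"
          using d_num_scale[OF t assms] floor_eq_nat[OF k] by simp
        moreover have "\<bar>real k * ln a\<bar> = real k * \<bar>ln a\<bar>" by (simp add: abs_mult)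
        ultimately show ?thesis
          using abs_triangle_ineq[of "d_num 1 t" "real k * ln a"] d_num_nonneg[OF k, of 1] by simp
      qed
      have "\<bar>d_num a t\<bar> / (t * W t * (1 + t)) \<le> (3 + \<bar>ln a\<bar>) * (1 / (t * W t)) + 4 * (p k t / (1 + real k)\<^sup>2)"
      \<comment> \<open>On the first interval \<open>1 / t\<close> is unbounded and must be
        cancelled by the numerator, which is of order \<open>t\<close>; afterwards
        \<open>t > k \<ge> 1\<close> and linear growth is affordable.\<close>
      proof (cases "k = 0")
        case True
        have "\<bar>d_num a t\<bar> \<le> 2 * t / sqrt (1 - t)" using d_num_a d_num_le_first[OF t] k True by simp
        hence "\<bar>d_num a t\<bar> / (t * W t * (1 + t)) \<le> (2 * t / sqrt (1 - t)) / (t * 1 * 1)"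
          using t W[of t] k True by (intro frac_le mult_mono) auto
        also have "\<dots> = 2 * (1 / sqrt (1 - t))" using t by simp
        also have "\<dots> \<le> 4 * p k t"
        proof -
          have "2 * y \<le> 4 * (x + y)" if "0 \<le> x" "0 \<le> y" for x y :: real using that by simp
          from this[of "1 / sqrt t" "1 / sqrt (1 - t)"] show ?thesis
            using True k t by (simp add: p_def add.commute)
        qed
        finally show ?thesis using True t W0[of t] by (simp add: add_increasing)
      next
        case False
        hence k1: "real k \<ge> 1" by simp
        have pk: "2 / sqrt (t - real k) + 2 / sqrt (1 - (t - real k)) = 2 * p k t"
          by (simp add: p_def algebra_simps)
        have "\<bar>d_num a t\<bar> \<le> 1 + 2 * t + 2 * p k t + real k * \<bar>ln a\<bar>"
          using d_num_a d_num_le_later[OF k] False pk by simp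
        also have "\<dots> \<le> (3 + \<bar>ln a\<bar>) * (1 + t) + 2 * p k t"
        proof -
          have "real k * \<bar>ln a\<bar> \<le> (1 + t) * \<bar>ln a\<bar>" using k by (intro mult_right_mono) auto
          thus ?thesis using t by (simp add: algebra_simps)
        qed
        finally have "\<bar>d_num a t\<bar> / (t * W t * (1 + t))
            \<le> ((3 + \<bar>ln a\<bar>) * (1 + t) + 2 * p k t) / (t * W t * (1 + t))"
          using t W0[of t] by (intro divide_right_mono) auto
        also have "\<dots> = (3 + \<bar>ln a\<bar>) * (1 / (t * W t)) + 2 * p k t / (t * W t * (1 + t))"
          using t W0[of t] by (simp add: add_divide_distrib)
        \<comment> \<open>Uses \<open>1 + k \<le> 2 * k\<close> for
          \<open>k \<ge> 1\<close>.\<close>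
        also have "2 * p k t / (t * W t * (1 + t)) \<le> 2 * p k t / ((1 + real k)\<^sup>2 / 2)"
        proof (intro divide_left_mono)
          have "(1 + real k)\<^sup>2 / 2 \<le> real k * 1 * (1 + real k)"
            using mult_mono[OF k1 k1] by (simp add: power2_eq_square algebra_simps)
          also have "\<dots> \<le> t * W t * (1 + t)" using k W[of t] W0[of t] t
            by (intro mult_mono) auto
          finally show "(1 + real k)\<^sup>2 / 2 \<le> t * W t * (1 + t)" .
        qed (use p t W0[of t] in \<open>auto intro!: mult_pos_pos\<close>)
        finally show ?thesis by simp
      qed
      thus ?thesis using t unfolding g_def sum_f dr by simp
    qed (simp add: g_def f_neg)
    moreover have "norm (indicat_real {0..} t *\<^sub>R (dr a t / (1 + t))) = indicat_real {0..} t *\<^sub>R \<bar>dr a t / (1 + t)\<bar>"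
      by (simp only: real_norm_def real_scaleR_def abs_mult abs_of_nonneg[OF indicator_pos_le])
    ultimately show ?case unfolding real_norm_def by linarith
  qed
  show ?thesis unfolding set_integrable_def
    by (rule Bochner_Integration.integrable_bound[OF g _ bound]) measurable
qed

text \<open>Makes a multiple of \<open>1 / (1 + t)\<close> a majorant of the kernel for each point
  off the cut, so that the integrability of \<open>dr a t / (1 + t)\<close> serves all
  \<open>z\<close>. Compactness handles \<open>t \<le> T\<close>, the triangle inequality the
  rest.\<close>

lemma slit_plane_add_lower_bound:
  assumes "z \<in> slit_plane"
  obtains c where "c > 0" "\<And>t. t \<ge> 0 \<Longrightarrow> norm (z + of_real t) \<ge> c * (1 + t)"
proof -
  \<comment> \<open>For \<open>t > T\<close> one has \<open>norm z < (t - 1) / 2\<close>, hence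
    \<open>t - norm z > (1 + t) / 2\<close>, more than the factor 1/4 demands.\<close>
  define T where "T = 2 * norm z + 1"
  have nz: "z + of_real t \<noteq> 0" if "t \<ge> 0" for t
    using assms that by (auto simp: complex_nonpos_Reals_iff complex_eq_iff)
  have "continuous_on {0..T} (\<lambda>t. norm (z + of_real t))" by (intro continuous_intros)
  then obtain t0 where t0: "t0 \<in> {0..T}" "\<And>t. t \<in> {0..T} \<Longrightarrow> norm (z + of_real t0) \<le> norm (z + of_real t)"
    using continuous_attains_inf[of "{0..T}" "\<lambda>t. norm (z + of_real t)"] by (auto simp: T_def)
  define m where "m = norm (z + of_real t0)"
  have m: "m > 0" using nz t0 by (simp add: m_def)
  show ?thesis
  proof (rule that[of "min (1/4) (m / (1 + T))"])
    show "min (1/4) (m / (1 + T)) > 0" using m by (simp add: T_def add_pos_nonneg)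
    fix t :: real assume t: "t \<ge> 0"
    show "norm (z + of_real t) \<ge> min (1/4) (m / (1 + T)) * (1 + t)"
    proof (cases "t \<le> T")
      case True
      have "min (1/4) (m / (1 + T)) * (1 + t) \<le> m / (1 + T) * (1 + T)"
        using True t m by (intro mult_mono) auto
      also have "\<dots> = m" by (simp add: T_def add_nonneg_eq_0_iff)
      also have "\<dots> \<le> norm (z + of_real t)" using t0 True t by (simp add: m_def)
      finally show ?thesis .
    next
      case False
      have "min (1/4) (m / (1 + T)) * (1 + t) \<le> 1/4 * (1 + t)"
        using t by (intro mult_right_mono min.cobounded1) auto
      also have "\<dots> \<le> t - norm z"
      proof -
        have "1/4 * (1 + t) \<le> t - n" if "\<not> t \<le> 2 * n + 1" "0 \<le> n" for n
          using that by (simp add: field_simps)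
        from this[OF False[unfolded T_def] norm_ge_zero] show ?thesis .
      qed
      also have "\<dots> \<le> norm (z + of_real t)"
        using norm_triangle_ineq4[of "z + of_real t" z] t by simp
      finally show ?thesis .
    qed
  qed
qed

lemma set_integrable_F_integrand:
  assumes "a > 0" "z \<in> slit_plane"
  shows "set_integrable lborel {0..} (F_integrand a z)"
proof -
  obtain c where c: "c > 0" "\<And>t. t \<ge> 0 \<Longrightarrow> norm (z + of_real t) \<ge> c * (1 + t)"
    using slit_plane_add_lower_bound[OF assms(2)] by blast
  have "integrable lborel (\<lambda>t. (1 / c) * (indicat_real {0..} t *\<^sub>R (dr a t / (1 + t))))"
    using set_integrable_dr[OF assms(1)] unfolding set_integrable_def by (rule integrable_mult_right)
  thus ?thesis unfolding set_integrable_def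
  proof (rule Bochner_Integration.integrable_bound)
    show "AE t in lborel. norm (indicat_real {0..} t *\<^sub>R F_integrand a z t)
            \<le> norm (1 / c * (indicat_real {0..} t *\<^sub>R (dr a t / (1 + t))))"
    proof (intro AE_I2)
      fix t :: real
      have *: "\<bar>r\<bar> / norm (z + of_real t) \<le> \<bar>r\<bar> / (c * (1 + t))" if "t \<ge> 0" for r
      proof (intro divide_left_mono mult_pos_pos)
        have "0 < c * (1 + t)" using that c by simp
        thus "0 < norm (z + of_real t)" using c(2)[OF that] by linarith
      qed (use that c in auto)
      show "norm (indicat_real {0..} t *\<^sub>R F_integrand a z t)
            \<le> norm (1 / c * (indicat_real {0..} t *\<^sub>R (dr a t / (1 + t))))"
        using c *[of "dr a t"] by (auto simp: indicator_def norm_divide norm_mult abs_mult)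
    qed
  qed measurable
qed

section \<open>The logarithm of Gamma on the slit plane\<close>

lemma of_real_add_in_slit_plane: "z \<in> slit_plane \<Longrightarrow> r \<ge> 0 \<Longrightarrow> z + of_real r \<in> slit_plane"
  by (auto simp: complex_nonpos_Reals_iff)

lemma slit_plane_add_of_nat: "z \<in> slit_plane \<Longrightarrow> z + of_nat n \<in> slit_plane"
  using of_real_add_in_slit_plane[of z "real n"] by simp

lemma connected_slit_plane: "connected slit_plane"
proof -
  have "(complex_of_real ` {..0}) = \<real>\<^sub>\<le>\<^sub>0" by (auto simp: nonpos_Reals_def)
  thus ?thesis using starlike_imp_connected[OF starlike_slotted_complex_plane_left[of 0]] by simp
qed

text \<open>The recurrence of Gamma alone determines this up to multiples of
  \<open>2 * pi * \<i>\<close>. The branch is fixed because the difference has derivative zero, by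
  the recurrence of \<open>Digamma\<close>, on a connected set, and vanishes at 1.\<close>

lemma ln_Gamma_plus1_slit:
  assumes "z \<in> slit_plane"
  shows "ln_Gamma (z + 1) = ln_Gamma z + Ln z"
proof -
  define f :: "complex \<Rightarrow> complex" where "f z = ln_Gamma (z + 1) - ln_Gamma z - Ln z" for z
  have "f constant_on slit_plane"
  proof (rule has_field_derivative_0_imp_constant_on[OF _ connected_slit_plane])
    fix z :: complex assume z: "z \<in> slit_plane"
    hence z1: "z + 1 \<in> slit_plane" using slit_plane_add_of_nat[of z 1] by simp
    have "z \<noteq> 0" using z by auto
    have "(f has_field_derivative (Digamma (z + 1) - Digamma z - 1 / z)) (at z)"
      unfolding f_def using z z1 by (auto intro!: derivative_eq_intros simp: inverse_eq_divide)
    thus "(f has_field_derivative 0) (at z)"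
      using Digamma_plus1[OF \<open>z \<noteq> 0\<close>] by simp
  qed (auto intro: open_Compl)
  moreover have "1 \<in> slit_plane" by auto
  ultimately have "f z = f 1" using assms unfolding constant_on_def by metis
  also have "f 1 = 0"
    using ln_Gamma_complex_conv_fact[of 2] ln_Gamma_complex_conv_fact[of 1] by (simp add: f_def)
  finally show ?thesis by (simp add: f_def diff_eq_eq add.commute)
qed

lemma ln_Gamma_shift:
  assumes "z \<in> slit_plane"
  shows "ln_Gamma (z + 1) = ln_Gamma (z + 1 + of_nat M) - (\<Sum>i<M. Ln (z + of_nat (Suc i)))"
proof (induction M)
  case (Suc M)
  have "ln_Gamma (z + of_nat (Suc M) + 1) = ln_Gamma (z + of_nat (Suc M)) + Ln (z + of_nat (Suc M))"
    using slit_plane_add_of_nat[OF assms] by (intro ln_Gamma_plus1_slit) blast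
  thus ?case using Suc by (simp add: algebra_simps)
qed simp

lemma norm_Ln_le_abs:
  assumes "z \<noteq> 0"
  shows "norm (Ln z) \<le> \<bar>ln (norm z)\<bar> + pi"
proof -
  have "norm (Ln z) \<le> \<bar>Re (Ln z)\<bar> + \<bar>Im (Ln z)\<bar>" by (rule cmod_le)
  moreover have "\<bar>Im (Ln z)\<bar> \<le> pi" using Im_Ln_le_pi[OF assms] mpi_less_Im_Ln[OF assms] by linarith
  ultimately show ?thesis using assms by simp
qed

lemma norm_Ln_le_sqrt:
  assumes "0 < r" "r \<le> norm z"
  shows "norm (Ln z) \<le> norm z + 2 / sqrt r + pi"
proof -
  have "- ln (norm z) \<le> 2 / sqrt (norm z)" using assms by (intro minus_ln_le_sqrt') auto
  also have "\<dots> \<le> 2 / sqrt r"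
    using assms by (intro divide_left_mono mult_pos_pos) (auto intro: less_le_trans)
  finally have "- ln (norm z) \<le> 2 / sqrt r" .
  moreover have "ln (norm z) \<le> norm z" using assms ln_less_self[of "norm z"] by linarith
  moreover have "0 \<le> 2 / sqrt r" using assms by simp
  ultimately have "\<bar>ln (norm z)\<bar> \<le> norm z + 2 / sqrt r" using norm_ge_zero[of z] by linarith
  thus ?thesis using norm_Ln_le_abs[of z] assms by force
qed

text \<open>
  Uniform up to the cut: shifting by \<open>M\<close> isolates the logarithmic singularities at
  \<open>-1, \<dots>, -M\<close>. Provides the dominating function for \<open>\<theta> \<rightarrow> pi\<close>.
\<close>

lemma norm_ln_Gamma_le_sqrt:
  assumes "T < real M"
  obtains C where "\<And>z. z \<in> slit_plane \<Longrightarrow> norm z \<le> T \<Longrightarrow> norm z \<notin> \<int> \<Longrightarrow>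
      norm (ln_Gamma (z + 1)) \<le> C + (\<Sum>i<M. 2 / sqrt \<bar>norm z - real (Suc i)\<bar>)"
proof -
  have sub: "(\<lambda>z::complex. z + 1 + of_nat M) ` cball 0 T \<subseteq> slit_plane"
  proof
    fix w :: complex assume "w \<in> (\<lambda>z. z + 1 + of_nat M) ` cball 0 T"
    then obtain z :: complex where z: "z \<in> cball 0 T" "w = z + 1 + of_nat M" by auto
    hence "Re z \<ge> - T" using abs_Re_le_cmod[of z] by simp
    thus "w \<in> slit_plane" using assms z by (auto simp: complex_nonpos_Reals_iff)
  qed
  have "continuous_on slit_plane (ln_Gamma :: complex \<Rightarrow> complex)"
    by (intro holomorphic_on_imp_continuous_on holomorphic_ln_Gamma) auto
  moreover have "continuous_on (cball 0 T) (\<lambda>z::complex. z + 1 + of_nat M)"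
    by (intro continuous_intros)
  ultimately have "continuous_on (cball 0 T) (\<lambda>z::complex. ln_Gamma (z + 1 + of_nat M))"
    by (rule continuous_on_compose2) (rule sub)
  hence "bounded ((\<lambda>z::complex. ln_Gamma (z + 1 + of_nat M)) ` cball 0 T)"
    by (intro compact_imp_bounded compact_continuous_image compact_cball)
  then obtain C0 where C0: "\<And>z::complex. z \<in> cball 0 T \<Longrightarrow> norm (ln_Gamma (z + 1 + of_nat M)) \<le> C0"
    unfolding bounded_iff ball_simps by blast
  show ?thesis
  proof (rule that[of "C0 + real M * (T + real M + pi)"])
    fix z :: complex assume z: "z \<in> slit_plane" "norm z \<le> T" "norm z \<notin> \<int>"
    have "norm (\<Sum>i<M. Ln (z + of_nat (Suc i))) \<le> (\<Sum>i<M. norm (Ln (z + of_nat (Suc i))))"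
      by (rule norm_sum)
    also have "\<dots> \<le> (\<Sum>i<M. (T + real M + pi) + 2 / sqrt \<bar>norm z - real (Suc i)\<bar>)"
    proof (intro sum_mono)
      fix i assume i: "i \<in> {..<M}"
      have "norm z \<noteq> real (Suc i)" using z(3) by (metis Ints_of_nat)
      \<comment> \<open>The reverse triangle inequality gives a bound in terms of
        \<open>norm z\<close> only, hence uniform in the argument of \<open>z\<close>.\<close>
      moreover have "\<bar>norm z - real (Suc i)\<bar> \<le> norm (z + of_nat (Suc i))"
        using norm_triangle_ineq3[of z "- of_nat (Suc i)"] by (simp only: norm_minus_cancel norm_of_nat diff_minus_eq_add)
      ultimately have "norm (Ln (z + of_nat (Suc i)))
          \<le> norm (z + of_nat (Suc i)) + 2 / sqrt \<bar>norm z - real (Suc i)\<bar> + pi"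
        by (intro norm_Ln_le_sqrt) auto
      moreover have "norm (z + of_nat (Suc i)) \<le> T + real M"
      proof -
        have "norm (z + of_nat (Suc i)) \<le> norm z + norm (of_nat (Suc i) :: complex)"
          by (rule norm_triangle_ineq)
        also have "norm (of_nat (Suc i) :: complex) = real (Suc i)" by (rule norm_of_nat)
        finally show ?thesis using z(2) i by simp
      qed
      ultimately show "norm (Ln (z + of_nat (Suc i))) \<le> (T + real M + pi) + 2 / sqrt \<bar>norm z - real (Suc i)\<bar>"
        by linarith
    qed
    also have "\<dots> = real M * (T + real M + pi) + (\<Sum>i<M. 2 / sqrt \<bar>norm z - real (Suc i)\<bar>)"
      by (subst sum.distrib) simp
    finally have "norm (\<Sum>i<M. Ln (z + of_nat (Suc i)))
        \<le> real M * (T + real M + pi) + (\<Sum>i<M. 2 / sqrt \<bar>norm z - real (Suc i)\<bar>)" .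
    moreover have "norm (ln_Gamma (z + 1 + of_nat M)) \<le> C0" using C0 z by simp
    ultimately show "norm (ln_Gamma (z + 1)) \<le> C0 + real M * (T + real M + pi)
        + (\<Sum>i<M. 2 / sqrt \<bar>norm z - real (Suc i)\<bar>)"
      unfolding ln_Gamma_shift[OF z(1), of M]
      using norm_triangle_ineq4[of "ln_Gamma (z + 1 + of_nat M)" "\<Sum>i<M. Ln (z + of_nat (Suc i))"]
      by linarith
  qed
qed

section \<open>Boundary values on the cut and growth on circles\<close>

lemma in_slit_plane_if_Im_nonzero: "Im z \<noteq> 0 \<Longrightarrow> z \<in> slit_plane"
  by (auto simp: complex_nonpos_Reals_iff)

text \<open>\<open>\<sigma>\<close> records the side of the real axis from which the limit is taken.
  For \<open>x < 0\<close>, passing to \<open>- w n\<close> reaches a point where \<open>Ln\<close>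
  is continuous, and the price is \<open>\<sigma> * pi * \<i>\<close>.\<close>

lemma tendsto_Ln_negative_axis:
  fixes w :: "nat \<Rightarrow> complex"
  assumes "w \<longlonglongrightarrow> of_real x" "x \<noteq> 0" "\<sigma> = 1 \<or> \<sigma> = -1" "\<And>n. \<sigma> * Im (w n) > 0"
  shows "(\<lambda>n. Ln (w n)) \<longlonglongrightarrow> of_real (ln \<bar>x\<bar>) + (if x < 0 then \<sigma> * pi * \<i> else 0)"
proof (cases "x < 0")
  case True
  have "Ln (w n) = Ln (- w n) + \<sigma> * pi * \<i>" for n
  proof -
    have "w n \<noteq> 0" using assms(4)[of n] by auto
    thus ?thesis using Ln_minus[of "- w n"] assms(3) assms(4)[of n] by (auto simp: algebra_simps)
  qed
  moreover have "(\<lambda>n. Ln (- w n) + \<sigma> * pi * \<i>) \<longlonglongrightarrow> Ln (- of_real x) + \<sigma> * pi * \<i>"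
    using assms(1) True by (intro tendsto_intros) (auto simp: complex_nonpos_Reals_iff)
  moreover have "Ln (- of_real x) = of_real (ln \<bar>x\<bar>)"
    using Ln_of_real[of "- x"] True by simp
  ultimately show ?thesis using True by simp
next
  case False
  have "(\<lambda>n. Ln (w n)) \<longlonglongrightarrow> Ln (of_real x)"
    using assms False by (intro tendsto_intros) (auto simp: complex_nonpos_Reals_iff)
  thus ?thesis using Ln_of_real[of x] False assms by simp
qed

text \<open>After shifting by the floor of \<open>t\<close>, the Gamma term is continuous at the
  limit point and each of the subtracted logarithms ends on the negative axis, contributing
  \<open>\<sigma> * pi * \<i>\<close>.\<close>

lemma tendsto_ln_Gamma_negative_axis:
  fixes w :: "nat \<Rightarrow> complex"
  assumes w: "w \<longlonglongrightarrow> - of_real t" and t: "t > 0" "t \<notin> \<int>"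
    and \<sigma>: "\<sigma> = 1 \<or> \<sigma> = -1" "\<And>n. \<sigma> * Im (w n) > 0"
  shows "(\<lambda>n. ln_Gamma (w n + 1)) \<longlonglongrightarrow> of_real (ln \<bar>Gamma (1 - t)\<bar>) - \<sigma> * pi * \<i> * of_int \<lfloor>t\<rfloor>"
proof -
  obtain M where M: "real M < t" "t < real M + 1"
    using obtain_unit_interval[of t] t by auto
  have slit: "w n \<in> slit_plane" for n
    by (rule in_slit_plane_if_Im_nonzero) (use \<sigma>(2)[of n] in auto)
  have "(\<lambda>n. ln_Gamma (w n + 1 + of_nat M) - (\<Sum>i<M. Ln (w n + of_nat (Suc i)))) \<longlonglongrightarrow>
          ln_Gamma (- of_real t + 1 + of_nat M) - (\<Sum>i<M. of_real (ln \<bar>t - real (Suc i)\<bar>) + \<sigma> * pi * \<i>)"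
  proof (intro tendsto_diff tendsto_sum)
    show "(\<lambda>n. ln_Gamma (w n + 1 + of_nat M)) \<longlonglongrightarrow> ln_Gamma (- of_real t + 1 + of_nat M)"
      by (rule isCont_tendsto_compose[of _ "ln_Gamma", OF isCont_ln_Gamma_complex[OF continuous_ident] tendsto_add[OF tendsto_add[OF w tendsto_const] tendsto_const]])
         (use M in \<open>auto simp: complex_nonpos_Reals_iff\<close>)
    fix i assume i: "i \<in> {..<M}"
    have neg: "real (Suc i) - t < 0" using i M by auto
    have "(\<lambda>n. w n + of_nat (Suc i)) \<longlonglongrightarrow> - of_real t + of_nat (Suc i)"
      by (intro tendsto_intros w)
    also have "- of_real t + of_nat (Suc i) = complex_of_real (real (Suc i) - t)" by simp
    finally have "(\<lambda>n. Ln (w n + of_nat (Suc i))) \<longlonglongrightarrow>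
        of_real (ln \<bar>real (Suc i) - t\<bar>) + (if real (Suc i) - t < 0 then \<sigma> * pi * \<i> else 0)"
      using neg \<sigma> by (intro tendsto_Ln_negative_axis) auto
    thus "(\<lambda>n. Ln (w n + of_nat (Suc i))) \<longlonglongrightarrow> of_real (ln \<bar>t - real (Suc i)\<bar>) + \<sigma> * pi * \<i>"
      using neg by (simp add: abs_minus_commute)
  qed
  also have "ln_Gamma (- of_real t + 1 + of_nat M) = complex_of_real (ln (Gamma (real M + 1 - t)))"
    using M ln_Gamma_complex_of_real[of "real M + 1 - t"]
    by (simp add: ln_Gamma_real_pos algebra_simps)
  also have "complex_of_real (ln (Gamma (real M + 1 - t)))
        - (\<Sum>i<M. of_real (ln \<bar>t - real (Suc i)\<bar>) + \<sigma> * pi * \<i>)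
      = of_real (ln \<bar>Gamma (1 - t)\<bar>) - \<sigma> * pi * \<i> * of_int \<lfloor>t\<rfloor>"
    unfolding ln_abs_Gamma_one_minus[OF t(2) M(2)] floor_eq_nat[OF M] by (simp add: sum.distrib)
  finally show ?thesis unfolding ln_Gamma_shift[OF slit, of _ M] .
qed

text \<open>Termwise estimate of the Weierstrass series of log Gamma. With \<open>u = z / k\<close>,
  a term is of order \<open>norm u ^ 2\<close> for small \<open>u\<close>; otherwise it is a
  logarithm that may come close to its singularity. Half-integer radii keep
  \<open>norm (1 + u)\<close> above \<open>1 / (2 * k)\<close>, so the loss is only
  \<open>sqrt k\<close>, and \<open>k powr (-3/2)\<close> is still summable.\<close>

lemma norm_ln_Gamma_half_integer_circles:
  obtains C where "C > 0" "\<And>n z. z \<in> slit_plane \<Longrightarrow> norm z = real n + 1 / 2 \<Longrightarrow>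
      norm (ln_Gamma (z + 1)) \<le> C * (norm z)\<^sup>2"
proof -
  define K where "K = (\<Sum>k. real (Suc k) powr (-3/2))"
  have "summable (\<lambda>k. real k powr (-3/2))" by (subst summable_real_powr_iff) simp
  hence summ: "summable (\<lambda>k. real (Suc k) powr (-3/2))" by (subst summable_Suc_iff)
  have K: "K \<ge> 0" unfolding K_def using summ by (intro suminf_nonneg) auto
  show ?thesis
  proof (rule that[of "36 * K + 2"])
    fix n :: nat and z :: complex
    assume z: "z \<in> slit_plane" and n: "norm z = real n + 1 / 2"
    define \<rho> where "\<rho> = norm z"
    have \<rho>: "\<rho> \<ge> 1 / 2" using n by (simp add: \<rho>_def)
    have z': "z \<notin> \<int>\<^sub>\<le>\<^sub>0" using z nonpos_Ints_subset_nonpos_Reals by blast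
    define f where "f k = z / of_nat (Suc k) - ln (1 + z / of_nat (Suc k))" for k
    have sums: "f sums (ln_Gamma (z + 1) + euler_mascheroni * z)"
      using ln_Gamma_series'_aux[OF z'] ln_Gamma_plus1_slit[OF z] unfolding f_def
      by (simp add: algebra_simps)
    have bound: "norm (f k) \<le> 36 * \<rho>\<^sup>2 * real (Suc k) powr (-3/2)" for k
    proof -
      define x where "x = real (Suc k)"
      define u where "u = z / of_nat (Suc k)"
      have x: "x \<ge> 1" by (simp add: x_def)
      have nu: "norm u = \<rho> / x" unfolding u_def x_def \<rho>_def norm_divide norm_of_nat ..
      have powr: "x powr (-3/2) = sqrt x / x\<^sup>2"
      proof -
        have "x powr (-3/2) = x powr (1/2 - 2)" by simp
        also have "\<dots> = x powr (1/2) / x powr 2" by (rule powr_diff)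
        finally show ?thesis using x by (simp add: powr_half_sqrt)
      qed
      have sq: "sqrt x \<ge> 1" using x by simp
      have eq: "36 * \<rho>\<^sup>2 * x powr (-3/2) = 36 * (norm u)\<^sup>2 * sqrt x"
        unfolding powr by (simp add: nu power_divide)
      have "norm (u - Ln (1 + u)) \<le> 36 * (norm u)\<^sup>2 * sqrt x"
      proof (cases "norm u \<le> 1 / 2")
        case True
        have "norm (u - Ln (1 + u)) \<le> (norm u)\<^sup>2 / (1 - norm u)"
          using Ln_approx_linear[of u] True by (simp add: norm_minus_commute)
        also have "\<dots> \<le> (norm u)\<^sup>2 / (1 / 2)" using True by (intro divide_left_mono) auto
        also have "\<dots> = 2 * (norm u)\<^sup>2 * 1" by simp
        also have "\<dots> \<le> 36 * (norm u)\<^sup>2 * sqrt x" using sq by (intro mult_mono) auto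
        finally show ?thesis .
      next
        case False
        \<comment> \<open>The only place where the radius has to be a half-integer: \<open>x\<close>
          is an integer.\<close>
        have "\<bar>x - \<rho>\<bar> \<ge> 1 / 2"
        proof (cases "n \<ge> Suc k")
          case True
          thus ?thesis using n by (simp add: x_def \<rho>_def)
        next
          case False
          hence "real n + 1 \<le> x" by (simp add: x_def)
          thus ?thesis using n by (simp add: \<rho>_def)
        qed
        moreover have "norm (1 + u) = norm (of_real x + z) / x"
        proof -
          have "1 + u = (of_real x + z) / of_real x"
          proof -
            have "1 + z / c = (c + z) / c" if "c \<noteq> 0" for c using that by (simp add: add_divide_distrib)
            moreover have "complex_of_real x \<noteq> 0" using x by simp
            moreover have "of_nat (Suc k) = complex_of_real x" by (simp add: x_def)
            ultimately show ?thesis unfolding u_def by metis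
          qed
          thus ?thesis using x by (simp add: norm_divide)
        qed
        moreover have "norm (of_real x + z) \<ge> \<bar>x - \<rho>\<bar>"
          using norm_triangle_ineq3[of "of_real x" "- z"] x by (simp add: \<rho>_def)
        ultimately have lower: "1 / (2 * x) \<le> norm (1 + u)" using x by (simp add: field_simps)
        have "norm (Ln (1 + u)) \<le> norm (1 + u) + 2 / sqrt (1 / (2 * x)) + pi"
          using lower x by (intro norm_Ln_le_sqrt) auto
        also have "2 / sqrt (1 / (2 * x)) = 2 * sqrt 2 * sqrt x"
          by (simp add: real_sqrt_divide real_sqrt_mult)
        also have "2 * sqrt 2 * sqrt x \<le> 3 * sqrt x"
        proof (intro mult_right_mono)
          have "sqrt 2 \<le> 3 / 2" by (rule real_le_lsqrt) (auto simp: power2_eq_square)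
          thus "2 * sqrt 2 \<le> 3" by simp
        qed (use x in auto)
        also have "pi \<le> 4 * sqrt x" using sq pi_less_4 by linarith
        also have "norm (1 + u) \<le> sqrt x + norm u" using norm_triangle_ineq[of 1 u] sq unfolding norm_one by linarith
        finally have "norm (Ln (1 + u)) \<le> norm u + 8 * sqrt x" by simp
        hence "norm (u - Ln (1 + u)) \<le> 2 * norm u * 1 + 8 * sqrt x"
          using norm_triangle_ineq4[of u "Ln (1 + u)"] by simp
        also have "\<dots> \<le> 2 * norm u * sqrt x + 8 * sqrt x"
          using sq by (intro add_right_mono mult_left_mono) auto
        also have "\<dots> = (2 * norm u + 8) * sqrt x" by (simp add: algebra_simps)
        \<comment> \<open>For \<open>norm u > 1 / 2\<close> the term \<open>2 * norm u\<close> is at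
          most \<open>4 * norm u ^ 2\<close> and 8 is at most \<open>32 * norm u ^ 2\<close>; this
          is the origin of 36.\<close>
        also have "\<dots> \<le> 36 * (norm u)\<^sup>2 * sqrt x"
        proof (intro mult_right_mono)
          have "(2 * norm u) * 1 \<le> (2 * norm u) * (2 * norm u)" using False by (intro mult_left_mono) auto
          moreover have "(1/2)\<^sup>2 \<le> (norm u)\<^sup>2" using False by (intro power_mono) auto
          ultimately show "2 * norm u + 8 \<le> 36 * (norm u)\<^sup>2"
            by (simp add: power2_eq_square)
        qed (use x in auto)
        finally show ?thesis by simp
      qed
      thus ?thesis unfolding f_def u_def[symmetric] x_def[symmetric] eq .
    qed
    have summ': "summable (\<lambda>k. 36 * \<rho>\<^sup>2 * real (Suc k) powr (-3/2))"
      by (intro summable_mult summ)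
    have "norm (suminf f) \<le> (\<Sum>k. norm (f k))"
      by (intro summable_norm summable_comparison_test[OF _ summ']) (use bound in auto)
    also have "\<dots> \<le> (\<Sum>k. 36 * \<rho>\<^sup>2 * real (Suc k) powr (-3/2))"
      by (intro suminf_le bound summ' summable_comparison_test[OF _ summ']) (use bound in auto)
    also have "\<dots> = 36 * \<rho>\<^sup>2 * K" unfolding K_def by (rule suminf_mult[OF summ])
    finally have 1: "norm (ln_Gamma (z + 1) + euler_mascheroni * z) \<le> 36 * \<rho>\<^sup>2 * K"
      using sums by (simp add: sums_iff)
    have em: "0 \<le> (euler_mascheroni :: real)" "(euler_mascheroni :: real) \<le> 1"
      using euler_mascheroni_pos euler_mascheroni_less_13_over_22 by linarith+
    have 2: "norm (euler_mascheroni * z) \<le> 2 * \<rho>\<^sup>2"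
    proof -
      have "norm (euler_mascheroni * z) = euler_mascheroni * \<rho>"
      proof -
        have "norm (of_real euler_mascheroni :: complex) = euler_mascheroni"
          using em by (simp only: norm_of_real abs_of_nonneg)
        thus ?thesis by (simp add: norm_mult \<rho>_def)
      qed
      also have "\<dots> \<le> 1 * \<rho>" using em \<rho> by (intro mult_right_mono) auto
      also have "\<dots> \<le> 2 * \<rho> * \<rho>" using \<rho> by (intro mult_right_mono) auto
      finally show ?thesis by (simp add: power2_eq_square)
    qed
    have "norm (ln_Gamma (z + 1)) \<le> norm (ln_Gamma (z + 1) + euler_mascheroni * z) + norm (euler_mascheroni * z)"
      using norm_triangle_ineq4[of "ln_Gamma (z + 1) + euler_mascheroni * z" "euler_mascheroni * z"] by simp
    also have "\<dots> \<le> 36 * \<rho>\<^sup>2 * K + 2 * \<rho>\<^sup>2" by (intro add_mono 1 2)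
    finally show "norm (ln_Gamma (z + 1)) \<le> (36 * K + 2) * (norm z)\<^sup>2"
      by (simp add: \<rho>_def algebra_simps)
  qed (use K in auto)
qed

section \<open>The Cauchy integral in the strip\<close>

text \<open>
  The pullback under \<open>\<zeta> = exp w\<close> of \<open>F\<^sub>a \<zeta> d\<zeta> / (\<zeta> - z)\<close>.
\<close>

definition strip_kernel :: "real \<Rightarrow> complex \<Rightarrow> complex \<Rightarrow> complex" where
  "strip_kernel a z w = ln_Gamma (exp w + 1) / ((w + of_real (ln a)) * (exp w - z))"

lemma exp_in_slit_plane:
  assumes "\<bar>Im w\<bar> < pi"
  shows "exp w \<in> slit_plane"
proof
  assume "exp w \<in> \<real>\<^sub>\<le>\<^sub>0"
  hence "exp (Re w) * sin (Im w) = 0" "exp (Re w) * cos (Im w) \<le> 0"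
    by (simp_all only: complex_nonpos_Reals_iff Re_exp Im_exp)
  hence *: "sin (Im w) = 0" "cos (Im w) \<le> 0"
    using exp_gt_zero[of "Re w"] by (simp, metis mult_pos_pos not_le)
  moreover have "- pi < Im w" "Im w < pi" using assms by linarith+
  ultimately have "Im w = 0" using sin_eq_0_pi by blast
  thus False using * by simp
qed

lemma ln_Gamma_exp_holomorphic: "(\<lambda>w. ln_Gamma (exp w + 1)) holomorphic_on {w. \<bar>Im w\<bar> < pi}"
proof -
  have "ln_Gamma holomorphic_on slit_plane" by (intro holomorphic_ln_Gamma) auto
  moreover have "(\<lambda>w. exp w + 1) holomorphic_on {w. \<bar>Im w\<bar> < pi}" by (intro holomorphic_intros)
  moreover have "(\<lambda>w. exp w + 1) ` {w. \<bar>Im w\<bar> < pi} \<subseteq> slit_plane"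
    using exp_in_slit_plane slit_plane_add_of_nat[of _ 1] by force
  ultimately show ?thesis using holomorphic_on_compose_gen unfolding o_def by blast
qed

lemma abs_Im_Ln_less_pi: "z \<in> slit_plane \<Longrightarrow> \<bar>Im (Ln z)\<bar> < pi"
  using Im_Ln_less_pi[of z] mpi_less_Im_Ln[of z] by (cases "z = 0") auto

lemma Ln_eq_minus_ln_iff:
  assumes "a > 0" "z \<in> slit_plane"
  shows "Ln z + of_real (ln a) = 0 \<longleftrightarrow> z = of_real (1 / a)"
proof
  assume "Ln z + of_real (ln a) = 0"
  hence "exp (Ln z) = exp (- of_real (ln a))" by (metis eq_neg_iff_add_eq_0)
  moreover have "z \<noteq> 0" using assms by auto
  ultimately show "z = of_real (1 / a)" using assms by (simp add: exp_minus exp_of_real inverse_eq_divide)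
next
  assume "z = of_real (1 / a)"
  thus "Ln z + of_real (ln a) = 0" using assms Ln_of_real[of "1 / a"] by (simp add: ln_div)
qed

text \<open>The exceptional value in the definition of \<open>F\<close> sits at \<open>1 / a\<close>
  for \<open>a = 1\<close>, so excluding \<open>1 / a\<close> leaves the quotient formula for every
  \<open>a\<close>.\<close>

lemma F_eq:
  assumes "a > 0" "z \<in> slit_plane" "z \<noteq> of_real (1 / a)"
  shows "F a z = ln_Gamma (z + 1) / (z * (Ln z + of_real (ln a)))"
proof -
  have "z \<noteq> 0" using assms by auto
  hence "Ln (of_real a * z) = of_real (ln a) + Ln z"
    using assms Ln_times_of_real[of a z] Ln_of_real[of a] by simp
  thus ?thesis using assms by (auto simp: F_def add.commute)
qed

lemma strip_kernel_holomorphic: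
  assumes "z \<in> slit_plane"
  shows "strip_kernel a z holomorphic_on {w. \<bar>Im w\<bar> < pi} - {Ln z, - of_real (ln a)}"
  unfolding strip_kernel_def
proof (intro holomorphic_intros holomorphic_on_subset[OF ln_Gamma_exp_holomorphic])
  fix w assume w: "w \<in> {w. \<bar>Im w\<bar> < pi} - {Ln z, - of_real (ln a)}"
  hence "exp w \<noteq> z" using Ln_exp[of w] by auto
  moreover have "w + of_real (ln a) \<noteq> 0" using w eq_neg_iff_add_eq_0[of w] by blast
  ultimately show "(w + of_real (ln a)) * (exp w - z) \<noteq> 0" by simp
qed auto

lemma open_strip: "open {w. \<bar>Im w\<bar> < pi}"
proof -
  have "{w. \<bar>Im w\<bar> < pi} = {w. Im w > - pi} \<inter> {w. Im w < pi}" by auto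
  thus ?thesis by (simp add: open_Int open_halfspace_Im_gt open_halfspace_Im_lt)
qed

lemma convex_strip: "convex {w. \<bar>Im w\<bar> < pi}"
proof -
  have "{w. \<bar>Im w\<bar> < pi} = {w. Im w > - pi} \<inter> {w. Im w < pi}" by auto
  thus ?thesis by (simp add: convex_Int convex_halfspace_Im_gt convex_halfspace_Im_lt)
qed

text \<open>The rectangle encloses \<open>Ln z\<close> and \<open>- ln a\<close>, which are distinct
  because \<open>z\<close> is not \<open>1 / a\<close>. The second residue is minus the pole term;
  for \<open>a = 1\<close> it is zero, so the removable singularity requires no separate
  treatment.\<close>

lemma strip_kernel_contour_integral:
  assumes a: "a > 0" and z: "z \<in> slit_plane" "z \<noteq> of_real (1 / a)"
    and R: "\<bar>Re (Ln z)\<bar> < R" "\<bar>ln a\<bar> < R" and \<theta>: "\<bar>Im (Ln z)\<bar> < \<theta>" "\<theta> < pi"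
  shows "contour_integral (rectpath (Complex (-R) (-\<theta>)) (Complex R \<theta>)) (strip_kernel a z)
       = 2 * pi * \<i> * (F a z - of_real (ln (Gamma (1 + 1 / a))) / (z - of_real (1 / a)))"
proof -
  define S where "S = {w. \<bar>Im w\<bar> < pi}"
  define \<gamma> where "\<gamma> = rectpath (Complex (-R) (-\<theta>)) (Complex R \<theta>)"
  define w0 w1 where "w0 = Ln z" and "w1 = - complex_of_real (ln a)"
  have w01: "w0 \<noteq> w1" using Ln_eq_minus_ln_iff[OF a z(1)] z(2) by (auto simp: w0_def w1_def)
  have nz: "w + of_real (ln a) \<noteq> 0" if "w \<noteq> w1" for w
    using that eq_neg_iff_add_eq_0[of w] unfolding w1_def by blast
  have opn: "open S" unfolding S_def by (rule open_strip)
  have z0: "z \<noteq> 0" using z by auto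
  hence exp_w0: "exp w0 = z" by (simp add: w0_def)
  have exp_w1: "exp w1 = of_real (1 / a)"
    using a by (simp add: w1_def exp_minus exp_of_real inverse_eq_divide)
  have inbox: "w0 \<in> box (Complex (-R) (-\<theta>)) (Complex R \<theta>)" "w1 \<in> box (Complex (-R) (-\<theta>)) (Complex R \<theta>)"
    using R \<theta> by (auto simp: in_box_complex_iff w0_def w1_def)
  hence S: "w0 \<in> S" "w1 \<in> S" using \<theta> by (auto simp: S_def in_box_complex_iff)
  have box_S: "cbox (Complex (-R) (-\<theta>)) (Complex R \<theta>) \<subseteq> S"
    using \<theta> by (auto simp: S_def in_cbox_complex_iff)
  have holo: "strip_kernel a z holomorphic_on S - {w0, w1}"
    unfolding S_def w0_def w1_def by (rule strip_kernel_holomorphic[OF z(1)])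
  have img: "path_image \<gamma> = cbox (Complex (-R) (-\<theta>)) (Complex R \<theta>) - box (Complex (-R) (-\<theta>)) (Complex R \<theta>)"
    unfolding \<gamma>_def using R \<theta> by (intro path_image_rectpath_cbox_minus_box) auto
  have isCont_G: "isCont (\<lambda>w. ln_Gamma (exp w + 1)) w" if "w \<in> S" for w
    using holomorphic_on_imp_continuous_on[OF ln_Gamma_exp_holomorphic] that opn
    by (auto simp: S_def continuous_on_eq_continuous_at)
  have "residue (strip_kernel a z) w0 = F a z"
  proof (rule residue_simple'[of "S - {w1}"])
    \<comment> \<open>The derivative of \<open>exp\<close> at \<open>w0\<close> is \<open>z\<close>;
      it supplies the factor \<open>z\<close> in the denominator of \<open>F a z\<close>.\<close>
    have "((\<lambda>w. (exp w - exp w0) / (w - w0)) \<longlongrightarrow> exp w0) (at w0)"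
      using DERIV_exp[of w0] by (simp add: has_field_derivative_iff)
    hence "((\<lambda>w. ln_Gamma (exp w + 1) / ((w + of_real (ln a)) * ((exp w - exp w0) / (w - w0)))) \<longlongrightarrow>
            ln_Gamma (exp w0 + 1) / ((w0 + of_real (ln a)) * exp w0)) (at w0)"
      using isCont_G[OF S(1)] nz[OF w01]
      by (intro tendsto_intros) (auto simp: isCont_def)
    also have "?this \<longleftrightarrow> ((\<lambda>w. strip_kernel a z w * (w - w0)) \<longlongrightarrow>
            ln_Gamma (exp w0 + 1) / ((w0 + of_real (ln a)) * exp w0)) (at w0)"
      by (intro tendsto_cong always_eventually allI) (simp add: strip_kernel_def exp_w0 field_simps)
    also have "ln_Gamma (exp w0 + 1) / ((w0 + of_real (ln a)) * exp w0) = F a z"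
      unfolding exp_w0 unfolding F_eq[OF a z] w0_def by (simp add: mult.commute)
    finally show "((\<lambda>w. strip_kernel a z w * (w - w0)) \<longlongrightarrow> F a z) (at w0)" .
    have "S - {w1} - {w0} = S - {w0, w1}" by auto
    thus "strip_kernel a z holomorphic_on S - {w1} - {w0}" using holo by simp
  qed (use S w01 opn in auto)
  moreover have "residue (strip_kernel a z) w1 = - of_real (ln (Gamma (1 + 1 / a))) / (z - of_real (1 / a))"
  proof (rule residue_simple'[of "S - {w0}"])
    have "((\<lambda>w. ln_Gamma (exp w + 1) / (exp w - z)) \<longlongrightarrow> ln_Gamma (exp w1 + 1) / (exp w1 - z)) (at w1)"
      using isCont_G[OF S(2)] z(2) exp_w1 by (intro tendsto_intros) (auto simp: isCont_def)
    moreover have "eventually (\<lambda>w. ln_Gamma (exp w + 1) / (exp w - z) = strip_kernel a z w * (w - w1)) (at w1)"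
      using eventually_neq_at_within[of w1]
    proof eventually_elim
      case (elim w)
      have "w - w1 = w + of_real (ln a)" by (simp add: w1_def)
      show ?case unfolding strip_kernel_def \<open>w - w1 = _\<close> using nz[OF elim] by simp
    qed
    ultimately have "((\<lambda>w. strip_kernel a z w * (w - w1)) \<longlongrightarrow> ln_Gamma (exp w1 + 1) / (exp w1 - z)) (at w1)"
      by (rule Lim_transform_eventually)
    also have "ln_Gamma (exp w1 + 1) = of_real (ln (Gamma (1 + 1 / a)))"
    proof -
      have pos: "1 + 1 / a > 0" using a by (simp add: add_pos_pos)
      have "exp w1 + 1 = of_real (1 + 1 / a)" by (simp add: exp_w1)
      thus ?thesis using ln_Gamma_complex_of_real[OF pos] ln_Gamma_real_pos[OF pos] by metis
    qed
    also have "of_real (ln (Gamma (1 + 1 / a))) / (exp w1 - z)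
        = - of_real (ln (Gamma (1 + 1 / a))) / (z - of_real (1 / a))"
      unfolding exp_w1 by (metis minus_diff_eq minus_divide_left minus_divide_right)
    finally show "((\<lambda>w. strip_kernel a z w * (w - w1)) \<longlongrightarrow> - of_real (ln (Gamma (1 + 1 / a))) / (z - of_real (1 / a))) (at w1)" .
    have "S - {w0} - {w1} = S - {w0, w1}" by auto
    thus "strip_kernel a z holomorphic_on S - {w0} - {w1}" using holo by simp
  qed (use S w01 opn in auto)
  moreover have "contour_integral \<gamma> (strip_kernel a z) = 2 * pi * \<i> * (\<Sum>p\<in>{w0, w1}. winding_number \<gamma> p * residue (strip_kernel a z) p)"
  proof (rule Residue_theorem[OF opn _ _ holo])
    show "connected S" unfolding S_def by (intro convex_connected convex_strip)
    show "path_image \<gamma> \<subseteq> S - {w0, w1}" using img box_S inbox by auto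
    show "\<forall>z. z \<notin> S \<longrightarrow> winding_number \<gamma> z = 0"
      unfolding \<gamma>_def using box_S R \<theta> by (intro allI impI winding_number_rectpath_outside) auto
  qed (auto simp: \<gamma>_def)
  moreover have "winding_number \<gamma> w0 = 1" "winding_number \<gamma> w1 = 1"
    unfolding \<gamma>_def by (intro winding_number_rectpath inbox)+
  ultimately show ?thesis unfolding \<gamma>_def[symmetric] using w01 by simp
qed

section \<open>Parametrising the sides of the rectangle\<close>

lemma contour_integral_linepath_same_Im:
  assumes "c < b" and cont: "continuous_on (closed_segment (Complex c y) (Complex b y)) f"
  shows "contour_integral (linepath (Complex c y) (Complex b y)) f = integral {c..b} (\<lambda>x. f (Complex x y))"
proof -
  have "contour_integral (linepath (Complex c y) (Complex b y)) f
      = (Complex b y - Complex c y) * integral {0..1} (\<lambda>x. f (linepath (Complex c y) (Complex b y) x))"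
    by (simp add: contour_integral_integral)
  also have "Complex b y - Complex c y = of_real (b - c)" by (simp add: complex_eq_iff)
  also have "of_real (b - c) * integral {0..1} (\<lambda>x. f (linepath (Complex c y) (Complex b y) x))
      = integral {0..1} (\<lambda>x. (b - c) *\<^sub>R f (linepath (Complex c y) (Complex b y) x))"
    by (simp add: scaleR_conv_of_real)
  also have "(\<lambda>x. (b - c) *\<^sub>R f (linepath (Complex c y) (Complex b y) x))
      = (\<lambda>x. (b - c) *\<^sub>R f (Complex ((b - c) * x + c) y))"
    by (intro ext arg_cong[of _ _ "\<lambda>w. (b - c) *\<^sub>R f w"])
       (simp add: linepath_def complex_eq_iff algebra_simps)
  also have "integral {0..1} \<dots> = integral {(b - c) * 0 + c..(b - c) * 1 + c} (\<lambda>x. f (Complex x y))"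
  proof (intro integral_unique has_integral_substitution[where c = c and d = b])
    have "(\<lambda>x. Complex x y) ` {c..b} \<subseteq> closed_segment (Complex c y) (Complex b y)"
      using assms(1) by (auto simp: closed_segment_same_Im closed_segment_eq_real_ivl)
    moreover have "continuous_on {c..b} (\<lambda>x. Complex x y)"
      unfolding Complex_eq by (intro continuous_intros)
    ultimately show "continuous_on {c..b} (\<lambda>x. f (Complex x y))"
      using continuous_on_compose2[OF cont] by blast
    show "(\<lambda>x. (b - c) * x + c) ` {0..1} \<subseteq> {c..b}"
    proof safe
      fix x :: real assume x: "x \<in> {0..1}"
      show "(b - c) * x + c \<in> {c..b}"
      proof -
        have "(b - c) * x \<le> (b - c) * 1" using assms(1) x by (intro mult_left_mono) auto
        moreover have "0 \<le> (b - c) * x" using assms(1) x by (intro mult_nonneg_nonneg) auto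
        ultimately show ?thesis by (simp only: atLeastAtMost_iff mult_1_right le_diff_eq le_add_same_cancel2)
      qed
    qed
  qed (use assms(1) in \<open>auto intro!: derivative_eq_intros\<close>)
  finally show ?thesis by simp
qed

lemma contour_integral_rectpath_horizontal:
  assumes R: "R > 0" and \<theta>: "\<theta> > 0"
    and cont: "continuous_on (path_image (rectpath (Complex (-R) (-\<theta>)) (Complex R \<theta>))) f"
    and B: "\<And>w. \<bar>Re w\<bar> = R \<Longrightarrow> \<bar>Im w\<bar> \<le> \<theta> \<Longrightarrow> norm (f w) \<le> B"
  shows "norm (contour_integral (rectpath (Complex (-R) (-\<theta>)) (Complex R \<theta>)) f
           - (integral {-R..R} (\<lambda>x. f (Complex x (-\<theta>))) - integral {-R..R} (\<lambda>x. f (Complex x \<theta>)))) \<le> 4 * \<theta> * B"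
proof -
  define p1 p2 p3 p4 where "p1 = Complex (-R) (-\<theta>)" "p2 = Complex R (-\<theta>)" "p3 = Complex R \<theta>" "p4 = Complex (-R) \<theta>"
  have rp: "rectpath p1 p3 = linepath p1 p2 +++ linepath p2 p3 +++ linepath p3 p4 +++ linepath p4 p1"
    by (simp add: rectpath_def p1_p2_p3_p4_def Let_def)
  have "path_image (rectpath p1 p3) = closed_segment p1 p2 \<union> closed_segment p2 p3 \<union> closed_segment p3 p4 \<union> closed_segment p4 p1"
    unfolding rp by (simp add: path_image_join Un_assoc)
  hence c: "continuous_on (closed_segment p1 p2) f" "continuous_on (closed_segment p2 p3) f"
      "continuous_on (closed_segment p3 p4) f" "continuous_on (closed_segment p4 p1) f"
    using cont unfolding p1_p2_p3_p4_def by (auto intro: continuous_on_subset)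
  note ci = c[THEN contour_integrable_continuous_linepath]
  have "contour_integral (rectpath p1 p3) f = contour_integral (linepath p1 p2) f + contour_integral (linepath p2 p3) f
      + contour_integral (linepath p3 p4) f + contour_integral (linepath p4 p1) f"
    unfolding rp using ci by (simp add: contour_integrable_joinI valid_path_join)
  moreover have "contour_integral (linepath p3 p4) f = - contour_integral (linepath p4 p3) f"
    by (rule contour_integral_reverse_linepath[OF c(3)])
  moreover have "contour_integral (linepath p1 p2) f = integral {-R..R} (\<lambda>x. f (Complex x (-\<theta>)))"
      "contour_integral (linepath p4 p3) f = integral {-R..R} (\<lambda>x. f (Complex x \<theta>))"
    using R c(1,3) unfolding p1_p2_p3_p4_def
    by (intro contour_integral_linepath_same_Im; simp add: closed_segment_commute)+
  ultimately have eq: "contour_integral (rectpath p1 p3) f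
           - (integral {-R..R} (\<lambda>x. f (Complex x (-\<theta>))) - integral {-R..R} (\<lambda>x. f (Complex x \<theta>)))
      = contour_integral (linepath p2 p3) f + contour_integral (linepath p4 p1) f"
    by simp
  have "norm (f (Complex R 0)) \<le> B" using R \<theta> by (intro B) auto
  hence B0: "B \<ge> 0" by (rule order.trans[OF norm_ge_zero])
  have seg: "norm (f w) \<le> B" if "w \<in> closed_segment p2 p3 \<or> w \<in> closed_segment p4 p1" for w
  proof (rule B)
    show "\<bar>Re w\<bar> = R" "\<bar>Im w\<bar> \<le> \<theta>"
      using that R \<theta> by (auto simp: p1_p2_p3_p4_def closed_segment_same_Re closed_segment_eq_real_ivl split: if_splits)
  qed
  have "norm (contour_integral (linepath p2 p3) f) \<le> B * norm (p3 - p2)"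
    using seg B0 ci by (intro contour_integral_bound_linepath) auto
  moreover have "norm (contour_integral (linepath p4 p1) f) \<le> B * norm (p1 - p4)"
    using seg B0 ci by (intro contour_integral_bound_linepath) auto
  moreover have "norm (p3 - p2) = 2 * \<theta>" "norm (p1 - p4) = 2 * \<theta>"
    using \<theta> by (simp_all add: p1_p2_p3_p4_def cmod_eq_Im)
  ultimately have "norm (contour_integral (linepath p2 p3) f + contour_integral (linepath p4 p1) f) \<le> 4 * \<theta> * B"
    by (intro order.trans[OF norm_triangle_ineq]) (simp add: algebra_simps)
  thus ?thesis using eq by (simp add: p1_p2_p3_p4_def)
qed

text \<open>Returns from the strip to the modulus \<open>t\<close> of the original variable, over
  which the density is integrated.\<close>

lemma integral_exp_substitution:
  fixes f :: "real \<Rightarrow> complex"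
  assumes "R > 0" "continuous_on {-R..R} f"
  shows "integral {-R..R} f = integral {exp (-R)..exp R} (\<lambda>t. f (ln t) / of_real t)"
proof -
  have "((\<lambda>t. (1 / t) *\<^sub>R f (ln t)) has_integral (integral {ln (exp (-R))..ln (exp R)} f)) {exp (-R)..exp R}"
  proof (rule has_integral_substitution[OF _ _ _ assms(2)])
    show "ln ` {exp (-R)..exp R} \<subseteq> {-R..R}"
    proof safe
      fix t assume t: "t \<in> {exp (-R)..exp R}"
      hence "t > 0" by (meson atLeastAtMost_iff exp_gt_zero less_le_trans)
      thus "ln t \<in> {-R..R}" using t by (simp add: ln_ge_iff) (metis exp_le_cancel_iff exp_ln)
    qed
    fix x assume "x \<in> {exp (-R)..exp R}"
    hence "x > 0" by (meson atLeastAtMost_iff exp_gt_zero less_le_trans)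
    thus "(ln has_field_derivative 1 / x) (at x within {exp (-R)..exp R})"
      by (auto intro!: derivative_eq_intros)
  qed (use assms in auto)
  thus ?thesis by (simp add: has_integral_iff scaleR_conv_of_real field_simps)
qed

text \<open>The singularity is now interior: it is majorised by the one-sided integrals on the two
  unit intervals adjacent to \<open>m\<close>, and by 1 at distance at least 1.\<close>

lemma set_integrable_inverse_sqrt_abs:
  assumes "A \<le> B"
  shows "set_integrable lborel {A..B} (\<lambda>t. 1 / sqrt \<bar>t - m\<bar>)"
proof -
  define g where "g t = indicator {A..B} t
      + indicator {m<..<m+1} t *\<^sub>R (1 / sqrt (t - m) + 1 / sqrt (m + 1 - t))
      + indicator {m-1<..<m-1+1} t *\<^sub>R (1 / sqrt (t - (m - 1)) + 1 / sqrt (m - 1 + 1 - t))" for t :: real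
  have "set_integrable lborel {A..B} (\<lambda>_. 1::real)"
    by (intro borel_integrable_atLeastAtMost' continuous_intros)
  hence "integrable lborel (indicat_real {A..B})" by (simp add: set_integrable_def)
  hence g: "integrable lborel g" unfolding g_def
    using inverse_sqrt_integral(1)[of m] inverse_sqrt_integral(1)[of "m - 1"]
    unfolding set_integrable_def by (intro Bochner_Integration.integrable_add) auto
  show ?thesis unfolding set_integrable_def
  proof (rule Bochner_Integration.integrable_bound[OF g])
    show "AE t in lborel. norm (indicat_real {A..B} t *\<^sub>R (1 / sqrt \<bar>t - m\<bar>)) \<le> norm (g t)"
    proof (intro AE_I2)
      fix t :: real
      have nonneg: "0 \<le> indicator {m<..<m+1} t *\<^sub>R (1 / sqrt (t - m) + 1 / sqrt (m + 1 - t))"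
        "0 \<le> indicator {m-1<..<m-1+1} t *\<^sub>R (1 / sqrt (t - (m - 1)) + 1 / sqrt (m - 1 + 1 - t))"
        by (auto simp: indicator_def)
      hence g0: "g t \<ge> 0" "g t \<ge> indicator {A..B} t" unfolding g_def by (auto simp: indicator_def)
      have "indicat_real {A..B} t * (1 / sqrt \<bar>t - m\<bar>) \<le> g t"
      proof (cases "t \<in> {A..B}")
        case True
        consider "t = m" | "\<bar>t - m\<bar> \<ge> 1" | "m < t" "t < m + 1" | "m - 1 < t" "t < m" by linarith
        thus ?thesis
        proof cases
          case 2
          hence "1 / sqrt \<bar>t - m\<bar> \<le> 1" by simp
          thus ?thesis using g0(2) True by simp
        next
          case 3
          thus ?thesis using True nonneg(2) unfolding g_def by simp
        next
          case 4
          thus ?thesis using True nonneg(1) unfolding g_def by simp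
        qed (use g0 in simp)
      qed (use g0 in simp)
      thus "norm (indicat_real {A..B} t *\<^sub>R (1 / sqrt \<bar>t - m\<bar>)) \<le> norm (g t)"
        using g0 by (simp add: abs_mult)
    qed
  qed measurable
qed

section \<open>The jump across the cut and the limit of the horizontal sides\<close>

lemma exp_Complex_ln: "t > 0 \<Longrightarrow> exp (Complex (ln t) y) = of_real t * cis y"
  by (simp add: exp_eq_polar exp_of_real)

text \<open>Boundary value from below minus boundary value from above. The denominators
  \<open>L - pi * \<i>\<close> and \<open>L + pi * \<i>\<close> multiply to
  \<open>L^2 + pi^2\<close>, and in the cross-multiplied numerator \<open>l * L\<close> and
  \<open>pi^2 * m\<close> cancel, leaving the numerator of the density. The sign comes from
  \<open>- t - z\<close>.\<close>

lemma jump_eq: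
  assumes a: "a > 0" and t: "t > 0" "t \<notin> \<int>" and z: "z \<in> slit_plane"
  defines "l \<equiv> complex_of_real (ln \<bar>Gamma (1 - t)\<bar>)" and "L \<equiv> complex_of_real (ln t + ln a)"
    and "m \<equiv> complex_of_int \<lfloor>t\<rfloor>"
  shows "(l + pi * \<i> * m) / ((L - pi * \<i>) * (- of_real t - z)) / t - (l - pi * \<i> * m) / ((L + pi * \<i>) * (- of_real t - z)) / t
       = - 2 * pi * \<i> * F_integrand a z t"
proof -
  have zt: "z + of_real t \<noteq> 0" using of_real_add_in_slit_plane[OF z, of t] t by auto
  have L: "L - pi * \<i> \<noteq> 0" "L + pi * \<i> \<noteq> 0"
    by (auto simp: L_def complex_eq_iff)
  have prod: "(L - pi * \<i>) * (L + pi * \<i>) = L\<^sup>2 + pi\<^sup>2"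
    by (simp add: algebra_simps power2_eq_square)
  have "(l + pi * \<i> * m) / (L - pi * \<i>) - (l - pi * \<i> * m) / (L + pi * \<i>)
      = ((l + pi * \<i> * m) * (L + pi * \<i>) - (l - pi * \<i> * m) * (L - pi * \<i>)) / (L\<^sup>2 + pi\<^sup>2)"
    unfolding prod[symmetric] using L by (simp add: diff_frac_eq mult.commute)
  also have "(l + pi * \<i> * m) * (L + pi * \<i>) - (l - pi * \<i> * m) * (L - pi * \<i>) = 2 * pi * \<i> * (l + m * L)"
    by (simp add: algebra_simps)
  finally have eq: "(l + pi * \<i> * m) / (L - pi * \<i>) - (l - pi * \<i> * m) / (L + pi * \<i>)
      = 2 * pi * \<i> * (l + m * L) / (L\<^sup>2 + pi\<^sup>2)" .
  have dr: "complex_of_real (dr a t) = (l + m * L) / (t * (L\<^sup>2 + pi\<^sup>2))"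
    using t a unfolding dr_eq[OF t(2)] d_num_def l_def m_def L_def
    by (simp add: ln_mult add.commute)
  have "(l + pi * \<i> * m) / ((L - pi * \<i>) * (- of_real t - z)) / t - (l - pi * \<i> * m) / ((L + pi * \<i>) * (- of_real t - z)) / t
      = ((l + pi * \<i> * m) / (L - pi * \<i>) - (l - pi * \<i> * m) / (L + pi * \<i>)) * (1 / ((- of_real t - z) * t))"
    by (simp add: divide_divide_eq_left diff_divide_distrib left_diff_distrib mult.assoc)
  also have "\<dots> = - 2 * pi * \<i> * F_integrand a z t"
  proof -
    define u where "u = z + of_real t"
    have "- complex_of_real t - z = - u" by (simp add: u_def)
    thus ?thesis unfolding eq dr u_def[symmetric] using t zt[folded u_def] by (simp add: mult_ac)
  qed
  finally show ?thesis .
qed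

lemma strip_kernel_continuous_horizontal:
  assumes "z \<in> slit_plane" "\<bar>Im (Ln z)\<bar> < \<bar>y\<bar>" "\<bar>y\<bar> < pi"
  shows "continuous_on X (\<lambda>x. strip_kernel a z (Complex x y))"
proof (rule continuous_on_compose2[OF holomorphic_on_imp_continuous_on[OF strip_kernel_holomorphic[OF assms(1)]]])
  show "continuous_on X (\<lambda>x. Complex x y)" unfolding Complex_eq by (intro continuous_intros)
  show "(\<lambda>x. Complex x y) ` X \<subseteq> {w. \<bar>Im w\<bar> < pi} - {Ln z, - of_real (ln a)}"
    using assms by (auto simp: complex_eq_iff)
qed

text \<open>The rays of argument plus or minus \<open>\<theta> n\<close> rotate onto the cut with
  the modulus \<open>t\<close> fixed, so both sides are compared at the same \<open>t\<close> and
  dominated convergence applies off the integers. With \<open>R\<close> fixed, only finitely many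
  singularities are in range.\<close>

lemma strip_kernel_horizontal_limit:
  fixes \<theta> :: "nat \<Rightarrow> real"
  assumes a: "a > 0" and z: "z \<in> slit_plane" and R: "R > 0"
    and \<theta>: "\<theta> \<longlonglongrightarrow> pi" "\<And>n. 1 \<le> \<theta> n" "\<And>n. \<theta> n < pi" "\<And>n. \<bar>Im (Ln z)\<bar> < \<theta> n"
  shows "(\<lambda>n. integral {-R..R} (\<lambda>x. strip_kernel a z (Complex x (- \<theta> n))) - integral {-R..R} (\<lambda>x. strip_kernel a z (Complex x (\<theta> n))))
      \<longlonglongrightarrow> - 2 * pi * \<i> * (LINT t:{exp (-R)..exp R}|lborel. F_integrand a z t)"
proof -
  define A B where "A = exp (-R)" "B = exp R"
  have A0: "A > 0" by (simp add: A_B_def)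
  have AB: "A \<le> B" using R by (simp add: A_B_def)
  obtain c where c: "c > 0" "\<And>t. t \<ge> 0 \<Longrightarrow> norm (z + of_real t) \<ge> c * (1 + t)"
    using slit_plane_add_lower_bound[OF z] by blast
  define g where "g y t = strip_kernel a z (Complex (ln t) y) / of_real t" for y t :: real
  have cont: "continuous_on {A..B} (g y)" if "\<bar>Im (Ln z)\<bar> < \<bar>y\<bar>" "\<bar>y\<bar> < pi" for y
    unfolding g_def
  proof (intro continuous_on_divide)
    show "continuous_on {A..B} (\<lambda>t. strip_kernel a z (Complex (ln t) y))"
      using A0 by (intro continuous_on_compose2[OF strip_kernel_continuous_horizontal[OF z that, of UNIV]] continuous_intros) auto
  qed (use A0 in \<open>auto intro!: continuous_intros\<close>)
  have \<theta>y: "\<bar>Im (Ln z)\<bar> < \<bar>\<sigma> * \<theta> n\<bar>" "\<bar>\<sigma> * \<theta> n\<bar> < pi" if "\<sigma> = 1 \<or> \<sigma> = -1" for \<sigma> n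
    using that \<theta>(2-4)[of n] by auto
  have int_g: "set_integrable lborel {A..B} (g (\<sigma> * \<theta> n))" if "\<sigma> = 1 \<or> \<sigma> = -1" for \<sigma> n
    using cont[OF \<theta>y[OF that]] by (rule borel_integrable_atLeastAtMost')
  have integral_eq: "integral {-R..R} (\<lambda>x. strip_kernel a z (Complex x (\<sigma> * \<theta> n))) = (LINT t:{A..B}|lborel. g (\<sigma> * \<theta> n) t)"
    if "\<sigma> = 1 \<or> \<sigma> = -1" for \<sigma> n
    unfolding set_borel_integral_eq_integral(2)[OF int_g[OF that]]
    using integral_exp_substitution[OF R strip_kernel_continuous_horizontal[OF z \<theta>y[OF that]]]
    by (simp add: A_B_def g_def[abs_def])

  define w where "w \<sigma> n t = complex_of_real t * cis (\<sigma> * \<theta> n)" for \<sigma> t :: real and n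
  have sin: "sin (\<theta> n) > 0" for n
    using \<theta>(2,3)[of n] by (intro sin_gt_zero) auto
  have Im_w: "\<sigma> * Im (w \<sigma> n t) > 0" if "\<sigma> = 1 \<or> \<sigma> = -1" "t > 0" for \<sigma> n t
    using that sin[of n] by (auto simp: w_def)
  have w_slit: "w \<sigma> n t \<in> slit_plane" if "\<sigma> = 1 \<or> \<sigma> = -1" "t > 0" for \<sigma> n t
    by (rule in_slit_plane_if_Im_nonzero) (use Im_w[OF that, of n] in auto)
  have norm_w: "norm (w \<sigma> n t) = t" if "t > 0" for \<sigma> n t
    using that by (simp add: w_def norm_mult)
  have g_eq: "g (\<sigma> * \<theta> n) t = ln_Gamma (w \<sigma> n t + 1) /
      ((Complex (ln t) (\<sigma> * \<theta> n) + of_real (ln a)) * (w \<sigma> n t - z)) / of_real t" if "t > 0" for \<sigma> n t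
    using that by (simp add: g_def strip_kernel_def exp_Complex_ln w_def)

  have cis_lim: "(\<lambda>n. cis (\<sigma> * \<theta> n)) \<longlonglongrightarrow> - 1" if "\<sigma> = 1 \<or> \<sigma> = -1" for \<sigma>
  proof -
    have "(\<lambda>n. cis (\<sigma> * \<theta> n)) \<longlonglongrightarrow> cis (\<sigma> * pi)"
      unfolding cis_conv_exp by (intro tendsto_intros \<theta>)
    moreover have "cis (\<sigma> * pi) = - 1" using that by (auto simp: complex_eq_iff)
    ultimately show ?thesis by simp
  qed
  have g_lim: "(\<lambda>n. g (\<sigma> * \<theta> n) t) \<longlonglongrightarrow> (of_real (ln \<bar>Gamma (1 - t)\<bar>) - \<sigma> * pi * \<i> * of_int \<lfloor>t\<rfloor>) /
      ((of_real (ln t + ln a) + \<sigma> * pi * \<i>) * (- of_real t - z)) / t" if \<sigma>: "\<sigma> = 1 \<or> \<sigma> = -1" and t: "t > 0" "t \<notin> \<int>" for \<sigma> t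
  proof -
    have "(\<lambda>n. w \<sigma> n t) \<longlonglongrightarrow> of_real t * (- 1)"
      unfolding w_def by (intro tendsto_intros cis_lim \<sigma>)
    hence w: "(\<lambda>n. w \<sigma> n t) \<longlonglongrightarrow> - of_real t" by simp
    have G: "(\<lambda>n. ln_Gamma (w \<sigma> n t + 1)) \<longlonglongrightarrow> of_real (ln \<bar>Gamma (1 - t)\<bar>) - \<sigma> * pi * \<i> * of_int \<lfloor>t\<rfloor>"
      by (rule tendsto_ln_Gamma_negative_axis[OF w t \<sigma>]) (use Im_w[OF \<sigma> t(1)] in auto)
    have L: "(\<lambda>n. Complex (ln t) (\<sigma> * \<theta> n) + of_real (ln a)) \<longlonglongrightarrow> of_real (ln t + ln a) + \<sigma> * pi * \<i>"
    proof -
      have "(\<lambda>n. Complex (ln t) (\<sigma> * \<theta> n) + of_real (ln a)) \<longlonglongrightarrow> Complex (ln t) (\<sigma> * pi) + of_real (ln a)"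
        by (intro tendsto_intros \<theta>)
      also have "Complex (ln t) (\<sigma> * pi) + of_real (ln a) = of_real (ln t + ln a) + \<sigma> * pi * \<i>"
        by (simp add: complex_eq_iff)
      finally show ?thesis .
    qed
    have nz1: "of_real (ln t + ln a) + \<sigma> * pi * \<i> \<noteq> 0" using \<sigma> by (auto simp: complex_eq_iff)
    have nz2: "- of_real t - z \<noteq> 0"
      using of_real_add_in_slit_plane[OF z, of t] t by (auto simp: algebra_simps eq_neg_iff_add_eq_0)
    show ?thesis unfolding g_eq[OF t(1)]
      by (intro tendsto_divide tendsto_mult tendsto_diff G L w tendsto_const) (use nz1 nz2 t in auto)
  qed

  obtain M where M: "B < real M" using reals_Archimedean2 by blast
  obtain C where C: "\<And>z. z \<in> slit_plane \<Longrightarrow> norm z \<le> B \<Longrightarrow> norm z \<notin> \<int> \<Longrightarrow>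
      norm (ln_Gamma (z + 1)) \<le> C + (\<Sum>i<M. 2 / sqrt \<bar>norm z - real (Suc i)\<bar>)"
    using norm_ln_Gamma_le_sqrt[OF M] by blast
  \<comment> \<open>\<open>1 / A\<close> bounds \<open>1 / t\<close>, \<open>2 / c\<close> bounds
    the Cauchy kernel, and the logarithm in the denominator has modulus at least 1 because
    \<open>\<theta> n \<ge> 1\<close>.\<close>
  define h where "h t = (C + (\<Sum>i<M. 2 * (1 / sqrt \<bar>t - real (Suc i)\<bar>))) * (2 / c) / A" for t
  have "set_integrable lborel {A..B} (\<lambda>t. 2 * (1 / sqrt \<bar>t - real (Suc i)\<bar>))" for i
    using set_integrable_inverse_sqrt_abs[OF AB] by (intro set_integrable_mult_right) auto
  hence "set_integrable lborel {A..B} (\<lambda>t. \<Sum>i<M. 2 * (1 / sqrt \<bar>t - real (Suc i)\<bar>))"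
    unfolding set_integrable_def scaleR_sum_right by (intro Bochner_Integration.integrable_sum) auto
  moreover have "set_integrable lborel {A..B} (\<lambda>_. C)"
    by (intro borel_integrable_atLeastAtMost' continuous_intros)
  ultimately have int_h: "set_integrable lborel {A..B} h" unfolding h_def
    by (intro set_integrable_divide set_integrable_mult_left set_integral_add(1))

  \<comment> \<open>The point at modulus \<open>t\<close> then lies within \<open>t * c / 2\<close>
    of \<open>- t\<close>, while \<open>z\<close> is at distance at least \<open>c * (1 + t)\<close>
    from \<open>- t\<close>; the difference is at least \<open>c / 2\<close> for all
    \<open>t\<close>.\<close>
  have "eventually (\<lambda>n. \<forall>\<sigma>\<in>{1, -1}. dist (cis (\<sigma> * \<theta> n)) (- 1) < c / 2) sequentially"
    using c(1) by (intro eventually_ball_finite ballI tendstoD[OF cis_lim]) auto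
  then obtain N where N: "\<And>n \<sigma>. n \<ge> N \<Longrightarrow> \<sigma> = 1 \<or> \<sigma> = -1 \<Longrightarrow> dist (cis (\<sigma> * \<theta> n)) (- 1) < c / 2"
    unfolding eventually_sequentially by blast
  have g_bound: "norm (g (\<sigma> * \<theta> n) t) \<le> h t"
    if \<sigma>: "\<sigma> = 1 \<or> \<sigma> = -1" and t: "t \<in> {A..B}" "t \<notin> \<int>" and n: "n \<ge> N" for \<sigma> n t
  proof -
    have t0: "t > 0" using t A0 by auto
    have 1: "norm (ln_Gamma (w \<sigma> n t + 1)) \<le> C + (\<Sum>i<M. 2 * (1 / sqrt \<bar>t - real (Suc i)\<bar>))"
      using C[OF w_slit[OF \<sigma> t0, of n]] norm_w[OF t0, of \<sigma> n] t by simp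
    have "\<bar>Im (Complex (ln t) (\<sigma> * \<theta> n) + of_real (ln a))\<bar> \<ge> 1"
      using \<sigma> \<theta>(2)[of n] by auto
    hence 2: "norm (Complex (ln t) (\<sigma> * \<theta> n) + of_real (ln a)) \<ge> 1"
      using abs_Im_le_cmod order.trans by blast
    have 3: "norm (w \<sigma> n t - z) \<ge> c / 2"
    proof -
      have "c * (1 + t) \<le> norm (z + of_real t)" using c(2) t0 by simp
      also have "\<dots> \<le> norm (w \<sigma> n t - z) + norm (of_real t * (cis (\<sigma> * \<theta> n) + 1))"
        using norm_triangle_ineq4[of "of_real t * (cis (\<sigma> * \<theta> n) + 1)" "w \<sigma> n t - z"]
        by (simp add: w_def algebra_simps)
      also have "norm (of_real t * (cis (\<sigma> * \<theta> n) + 1)) = t * dist (cis (\<sigma> * \<theta> n)) (- 1)"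
        using t0 by (simp add: norm_mult dist_norm)
      also have "\<dots> \<le> t * (c / 2)" using N[OF n \<sigma>] t0 by (intro mult_left_mono) auto
      finally have "c * (1 + t) \<le> norm (w \<sigma> n t - z) + t * (c / 2)" by simp
      moreover have "t * (c / 2) + c / 2 \<le> c * (1 + t)" using mult_pos_pos[OF c(1) t0] c(1) by (simp add: algebra_simps)
      ultimately show ?thesis by linarith
    qed
    have S0: "C + (\<Sum>i<M. 2 * (1 / sqrt \<bar>t - real (Suc i)\<bar>)) \<ge> 0"
      using 1 norm_ge_zero order.trans by blast
    have "norm (g (\<sigma> * \<theta> n) t) = norm (ln_Gamma (w \<sigma> n t + 1)) /
      (norm (Complex (ln t) (\<sigma> * \<theta> n) + of_real (ln a)) * norm (w \<sigma> n t - z)) / t"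
      unfolding g_eq[OF t0] norm_divide norm_mult using t0 by simp
    also have "\<dots> \<le> (C + (\<Sum>i<M. 2 * (1 / sqrt \<bar>t - real (Suc i)\<bar>))) / (1 * (c / 2)) / A"
      using 1 2 3 S0 c(1) t A0 by (intro frac_le mult_mono divide_nonneg_pos) auto
    also have "\<dots> = h t" by (simp add: h_def field_simps)
    finally show ?thesis .
  qed

  have AE_Int: "AE t in lborel. t \<notin> (\<int> :: real set)"
    by (intro AE_not_in countable_imp_null_set_lborel countable_int)
  define f where "f n t = indicator {A..B} t *\<^sub>R (g (- \<theta> n) t - g (\<theta> n) t)" for n t
  have "(\<lambda>n. integral\<^sup>L lborel (f (n + N))) \<longlonglongrightarrow>
      integral\<^sup>L lborel (\<lambda>t. indicator {A..B} t *\<^sub>R (- 2 * pi * \<i> * F_integrand a z t))"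
  proof (rule integral_dominated_convergence[where w = "\<lambda>t. indicator {A..B} t *\<^sub>R (2 * h t)"])
    show "integrable lborel (\<lambda>t. indicator {A..B} t *\<^sub>R (2 * h t))"
      using int_h unfolding set_integrable_def[symmetric] by (intro set_integrable_mult_right) auto
    fix n
    have "set_integrable lborel {A..B} (\<lambda>t. g (- \<theta> (n + N)) t - g (\<theta> (n + N)) t)"
      using int_g[of "-1" "n + N"] int_g[of 1 "n + N"] by (intro set_integral_diff) auto
    thus "f (n + N) \<in> borel_measurable lborel"
      unfolding f_def set_integrable_def by (rule borel_measurable_integrable)
    show "AE t in lborel. norm (f (n + N) t) \<le> indicator {A..B} t *\<^sub>R (2 * h t)"
      using AE_Int
    proof eventually_elim
      case (elim t)
      show ?case
      proof (cases "t \<in> {A..B}")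
        case True
        have "norm (g (- \<theta> (n + N)) t) \<le> h t" "norm (g (\<theta> (n + N)) t) \<le> h t"
          using g_bound[of "-1" t "n + N"] g_bound[of 1 t "n + N"] True elim by auto
        thus ?thesis using True norm_triangle_ineq4[of "g (- \<theta> (n + N)) t" "g (\<theta> (n + N)) t"]
          by (simp add: f_def)
      qed (simp add: f_def)
    qed
  next
    show "AE t in lborel. (\<lambda>n. f (n + N) t) \<longlonglongrightarrow> indicator {A..B} t *\<^sub>R (- 2 * pi * \<i> * F_integrand a z t)"
      using AE_Int
    proof eventually_elim
      case (elim t)
      show ?case
      proof (cases "t \<in> {A..B}")
        case True
        hence t0: "t > 0" using A0 by auto
        have "(\<lambda>n. g (- \<theta> n) t - g (\<theta> n) t) \<longlonglongrightarrow> - 2 * pi * \<i> * F_integrand a z t"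
          using tendsto_diff[OF g_lim[of "-1", OF _ t0 elim] g_lim[of 1, OF _ t0 elim]]
          unfolding jump_eq[OF a t0 elim z, symmetric] by simp
        from LIMSEQ_ignore_initial_segment[OF this, of N] show ?thesis
          using True by (simp add: f_def)
      qed (simp add: f_def)
    qed
  qed measurable
  hence "(\<lambda>n. integral\<^sup>L lborel (f n)) \<longlonglongrightarrow>
      integral\<^sup>L lborel (\<lambda>t. indicator {A..B} t *\<^sub>R (- 2 * pi * \<i> * F_integrand a z t))"
    by (rule LIMSEQ_offset)
  also have "integral\<^sup>L lborel (\<lambda>t. indicator {A..B} t *\<^sub>R (- 2 * pi * \<i> * F_integrand a z t))
      = - 2 * pi * \<i> * (LINT t:{A..B}|lborel. F_integrand a z t)"
    unfolding set_lebesgue_integral_def[symmetric] by (rule set_integral_mult_right)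
  also have "(\<lambda>n. integral\<^sup>L lborel (f n)) =
     (\<lambda>n. integral {-R..R} (\<lambda>x. strip_kernel a z (Complex x (- \<theta> n))) - integral {-R..R} (\<lambda>x. strip_kernel a z (Complex x (\<theta> n))))"
  proof
    fix n
    have "integral\<^sup>L lborel (f n) = (LINT t:{A..B}|lborel. g (- \<theta> n) t) - (LINT t:{A..B}|lborel. g (\<theta> n) t)"
      unfolding f_def set_lebesgue_integral_def[symmetric]
      using int_g[of "-1" n] int_g[of 1 n] by (intro set_integral_diff) auto
    thus "integral\<^sup>L lborel (f n) = integral {-R..R} (\<lambda>x. strip_kernel a z (Complex x (- \<theta> n))) - integral {-R..R} (\<lambda>x. strip_kernel a z (Complex x (\<theta> n)))"
      using integral_eq[of "-1" n] integral_eq[of 1 n] by simp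
  qed
  finally show ?thesis by (simp add: A_B_def)
qed

section \<open>The integral representation and the Pick property\<close>

definition F_minus_pole :: "real \<Rightarrow> complex \<Rightarrow> complex" where
  "F_minus_pole a z = F a z - of_real (ln (Gamma (1 + 1 / a))) / (z - of_real (1 / a))"

text \<open>\<open>B\<close> bounds the vertical sides in the whole open strip, so the inequality
  survives the limit in \<open>\<theta>\<close> with \<open>R\<close> fixed. Two sides of length at
  most \<open>2 * pi\<close> give \<open>4 * pi * B\<close>, and the factor
  \<open>2 * pi * \<i>\<close> of the residue theorem is divided out.\<close>

lemma F_minus_pole_difference_bound:
  assumes a: "a > 0" and z: "z \<in> slit_plane" "z \<noteq> of_real (1 / a)"
    and z': "z' \<in> slit_plane" "z' \<noteq> of_real (1 / a)"
    and R: "\<bar>Re (Ln z)\<bar> < R" "\<bar>Re (Ln z')\<bar> < R" "\<bar>ln a\<bar> < R"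
    and B: "\<And>w. \<bar>Re w\<bar> = R \<Longrightarrow> \<bar>Im w\<bar> < pi \<Longrightarrow> norm (strip_kernel a z w - strip_kernel a z' w) \<le> B"
  shows "norm ((F_minus_pole a z + (LINT t:{exp (-R)..exp R}|lborel. F_integrand a z t))
             - (F_minus_pole a z' + (LINT t:{exp (-R)..exp R}|lborel. F_integrand a z' t))) \<le> 2 * B"
proof -
  define m where "m = max 1 (max \<bar>Im (Ln z)\<bar> \<bar>Im (Ln z')\<bar>)"
  have m: "m < pi" using abs_Im_Ln_less_pi[OF z(1)] abs_Im_Ln_less_pi[OF z'(1)] pi_gt3 by (simp add: m_def)
  \<comment> \<open>The offset 2 makes \<open>m < \<theta> n\<close> strict already at
    \<open>n = 0\<close>.\<close>
  define \<theta> where "\<theta> n = pi - (pi - m) / (real n + 2)" for n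
  have \<theta>: "\<theta> \<longlonglongrightarrow> pi" unfolding \<theta>_def by real_asymp
  have \<theta>_pi: "\<theta> n < pi" for n using m by (simp add: \<theta>_def)
  have "(pi - m) / (real n + 2) < pi - m" for n using m by (simp add: divide_less_eq)
  hence m\<theta>: "m < \<theta> n" for n unfolding \<theta>_def by (simp add: less_diff_eq add.commute)
  have \<theta>': "1 \<le> \<theta> n" "\<bar>Im (Ln z)\<bar> < \<theta> n" "\<bar>Im (Ln z')\<bar> < \<theta> n" for n
    using m\<theta>[of n] by (auto simp: m_def)
  have R0: "R > 0" using R(3) by linarith
  define I where "I \<zeta> n = integral {-R..R} (\<lambda>x. strip_kernel a \<zeta> (Complex x (- \<theta> n))) - integral {-R..R} (\<lambda>x. strip_kernel a \<zeta> (Complex x (\<theta> n)))"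
    for \<zeta> n
  define S where "S \<zeta> = (LINT t:{exp (-R)..exp R}|lborel. F_integrand a \<zeta> t)" for \<zeta>
  have lim: "I z \<longlonglongrightarrow> - 2 * pi * \<i> * S z" "I z' \<longlonglongrightarrow> - 2 * pi * \<i> * S z'"
    unfolding I_def S_def by (intro strip_kernel_horizontal_limit a z z' R0 \<theta> \<theta>' \<theta>_pi)+
  have bound: "norm (2 * pi * \<i> * (F_minus_pole a z - F_minus_pole a z') - (I z n - I z' n)) \<le> 4 * pi * B" for n
  proof -
    define \<gamma> where "\<gamma> = rectpath (Complex (-R) (-\<theta> n)) (Complex R (\<theta> n))"
    define D where "D = {w. \<bar>Im w\<bar> < pi} - {Ln z, Ln z', - of_real (ln a)}"
    have opn: "open D" unfolding D_def by (intro open_Diff open_strip finite_imp_closed) auto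
    have "path_image \<gamma> = cbox (Complex (-R) (-\<theta> n)) (Complex R (\<theta> n)) - box (Complex (-R) (-\<theta> n)) (Complex R (\<theta> n))"
      unfolding \<gamma>_def using R0 \<theta>'(1)[of n] by (intro path_image_rectpath_cbox_minus_box) auto
    hence img: "path_image \<gamma> \<subseteq> D"
      using \<theta>_pi[of n] \<theta>'[of n] R by (auto simp: D_def in_cbox_complex_iff in_box_complex_iff)
    have holo: "strip_kernel a z holomorphic_on D" "strip_kernel a z' holomorphic_on D"
      by (rule holomorphic_on_subset[OF strip_kernel_holomorphic[OF z(1)]] holomorphic_on_subset[OF strip_kernel_holomorphic[OF z'(1)]];
          auto simp: D_def)+
    have val: "valid_path \<gamma>" by (simp add: \<gamma>_def)
    have "contour_integral \<gamma> (\<lambda>w. strip_kernel a z w - strip_kernel a z' w) = contour_integral \<gamma> (strip_kernel a z) - contour_integral \<gamma> (strip_kernel a z')"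
      by (intro contour_integral_diff contour_integrable_holomorphic_simple[OF _ opn val img] holo)
    also have "contour_integral \<gamma> (strip_kernel a z) = 2 * pi * \<i> * F_minus_pole a z"
      unfolding \<gamma>_def F_minus_pole_def by (intro strip_kernel_contour_integral a z R \<theta>' \<theta>_pi)
    also have "contour_integral \<gamma> (strip_kernel a z') = 2 * pi * \<i> * F_minus_pole a z'"
      unfolding \<gamma>_def F_minus_pole_def by (intro strip_kernel_contour_integral a z' R \<theta>' \<theta>_pi)
    finally have ci: "contour_integral \<gamma> (\<lambda>w. strip_kernel a z w - strip_kernel a z' w) = 2 * pi * \<i> * (F_minus_pole a z - F_minus_pole a z')"
      by (simp add: algebra_simps)
    have int: "(\<lambda>x. strip_kernel a \<zeta> (Complex x y)) integrable_on {-R..R}"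
      if "y = \<theta> n \<or> y = - \<theta> n" "\<zeta> = z \<or> \<zeta> = z'" for y \<zeta>
      using that \<theta>'[of n] \<theta>_pi[of n] z z'
      by (intro integrable_continuous_real strip_kernel_continuous_horizontal) auto
    have "norm (contour_integral \<gamma> (\<lambda>w. strip_kernel a z w - strip_kernel a z' w)
       - (integral {-R..R} (\<lambda>x. strip_kernel a z (Complex x (-\<theta> n)) - strip_kernel a z' (Complex x (-\<theta> n)))
          - integral {-R..R} (\<lambda>x. strip_kernel a z (Complex x (\<theta> n)) - strip_kernel a z' (Complex x (\<theta> n))))) \<le> 4 * \<theta> n * B"
      unfolding \<gamma>_def
    proof (rule contour_integral_rectpath_horizontal[OF R0, where f = "\<lambda>w. strip_kernel a z w - strip_kernel a z' w"])
      show "continuous_on (path_image (rectpath (Complex (- R) (- \<theta> n)) (Complex R (\<theta> n)))) (\<lambda>w. strip_kernel a z w - strip_kernel a z' w)"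
        unfolding \<gamma>_def[symmetric]
        by (intro continuous_on_subset[OF _ img] continuous_on_diff[OF holo[THEN holomorphic_on_imp_continuous_on]])
    qed (use \<theta>'(1)[of n] \<theta>_pi[of n] B in auto)
    also have "integral {-R..R} (\<lambda>x. strip_kernel a z (Complex x (-\<theta> n)) - strip_kernel a z' (Complex x (-\<theta> n)))
          - integral {-R..R} (\<lambda>x. strip_kernel a z (Complex x (\<theta> n)) - strip_kernel a z' (Complex x (\<theta> n))) = I z n - I z' n"
      using int by (simp add: integral_diff I_def)
    also have "4 * \<theta> n * B \<le> 4 * pi * B"
    proof -
      have "norm (strip_kernel a z (Complex R 0) - strip_kernel a z' (Complex R 0)) \<le> B"
        using R0 by (intro B) auto
      hence "B \<ge> 0" by (rule order.trans[OF norm_ge_zero])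
      thus ?thesis using \<theta>_pi[of n] by (intro mult_right_mono) auto
    qed
    finally show ?thesis unfolding ci .
  qed
  have "(\<lambda>n. norm (2 * pi * \<i> * (F_minus_pole a z - F_minus_pole a z') - (I z n - I z' n)))
      \<longlonglongrightarrow> norm (2 * pi * \<i> * (F_minus_pole a z - F_minus_pole a z') - (- 2 * pi * \<i> * S z - - 2 * pi * \<i> * S z'))"
    by (intro tendsto_intros lim)
  hence "norm (2 * pi * \<i> * (F_minus_pole a z - F_minus_pole a z') - (- 2 * pi * \<i> * S z - - 2 * pi * \<i> * S z')) \<le> 4 * pi * B"
    by (rule LIMSEQ_le_const2) (use bound in auto)
  also have "2 * pi * \<i> * (F_minus_pole a z - F_minus_pole a z') - (- 2 * pi * \<i> * S z - - 2 * pi * \<i> * S z')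
      = (2 * pi * \<i>) * ((F_minus_pole a z + S z) - (F_minus_pole a z' + S z'))"
    by (simp add: algebra_simps)
  also have "norm \<dots> = 2 * pi * norm ((F_minus_pole a z + S z) - (F_minus_pole a z' + S z'))"
    by (simp add: norm_mult)
  finally show ?thesis unfolding S_def by simp
qed

text \<open>Subtracting the Cauchy kernels yields \<open>(z - z')\<close> over a product of two
  distances, hence the second power of \<open>s\<close>; the real part of the logarithm yields
  \<open>R - \<bar>ln a\<bar>\<close>.\<close>

lemma strip_kernel_difference_bound:
  assumes D: "norm (ln_Gamma (exp w + 1)) \<le> C" and w: "\<bar>Re w\<bar> = R" "\<bar>ln a\<bar> < R"
    and s: "0 < s" "s \<le> norm (exp w - z)" "s \<le> norm (exp w - z')"
  shows "norm (strip_kernel a z w - strip_kernel a z' w) \<le> C / (R - \<bar>ln a\<bar>) * (norm (z - z') / s\<^sup>2)"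
proof -
  have nz: "exp w - z \<noteq> 0" "exp w - z' \<noteq> 0" using s by auto
  have "strip_kernel a z w - strip_kernel a z' w = ln_Gamma (exp w + 1) / (w + of_real (ln a)) * (1 / (exp w - z) - 1 / (exp w - z'))"
    by (simp add: strip_kernel_def right_diff_distrib)
  also have "1 / (exp w - z) - 1 / (exp w - z') = (z - z') / ((exp w - z) * (exp w - z'))"
    using nz by (simp add: diff_frac_eq)
  finally have eq: "norm (strip_kernel a z w - strip_kernel a z' w) = norm (ln_Gamma (exp w + 1)) / norm (w + of_real (ln a))
      * (norm (z - z') / (norm (exp w - z) * norm (exp w - z')))"
    by (simp add: norm_mult norm_divide)
  have "R - \<bar>ln a\<bar> \<le> \<bar>Re (w + of_real (ln a))\<bar>" using w(1) by auto
  also have "\<dots> \<le> norm (w + of_real (ln a))" by (rule abs_Re_le_cmod)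
  finally have L: "R - \<bar>ln a\<bar> \<le> norm (w + of_real (ln a))" .
  have "C \<ge> 0" using D norm_ge_zero order.trans by blast
  thus ?thesis unfolding eq power2_eq_square using D L w s
    by (intro mult_mono frac_le) auto
qed

lemma F_minus_pole_plus_integral_constant:
  assumes a: "a > 0" and z: "z \<in> slit_plane" "z \<noteq> of_real (1 / a)"
    and z': "z' \<in> slit_plane" "z' \<noteq> of_real (1 / a)"
  shows "F_minus_pole a z + (LINT t:{0..}|lborel. F_integrand a z t) = F_minus_pole a z' + (LINT t:{0..}|lborel. F_integrand a z' t)"
proof -
  define \<rho> where "\<rho> n = real n + 1 / 2" for n
  have \<rho>0: "\<rho> n > 0" for n by (simp add: \<rho>_def)
  obtain C where C: "C > 0" "\<And>n z. z \<in> slit_plane \<Longrightarrow> norm z = \<rho> n \<Longrightarrow> norm (ln_Gamma (z + 1)) \<le> C * (norm z)\<^sup>2"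
    using norm_ln_Gamma_half_integer_circles unfolding \<rho>_def by metis
  obtain C' where C': "\<And>z::complex. norm z \<le> 1 / 2 \<Longrightarrow> norm (ln_Gamma (z + 1)) \<le> C'"
  proof -
    have "(\<lambda>z::complex. z + 1) ` cball 0 (1 / 2) \<subseteq> slit_plane"
    proof safe
      fix z :: complex assume "z \<in> cball 0 (1/2)" "z + 1 \<in> \<real>\<^sub>\<le>\<^sub>0"
      thus False using abs_Re_le_cmod[of z] by (auto simp: complex_nonpos_Reals_iff)
    qed
    moreover have "continuous_on slit_plane (ln_Gamma :: complex \<Rightarrow> complex)"
      by (intro holomorphic_on_imp_continuous_on holomorphic_ln_Gamma) auto
    moreover have "continuous_on (cball 0 (1/2)) (\<lambda>z::complex. z + 1)" by (intro continuous_intros)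
    ultimately have "continuous_on (cball 0 (1/2)) (\<lambda>z::complex. ln_Gamma (z + 1))"
      using continuous_on_compose2 by blast
    hence "bounded ((\<lambda>z::complex. ln_Gamma (z + 1)) ` cball 0 (1/2))"
      by (intro compact_imp_bounded compact_continuous_image compact_cball)
    then obtain K where "\<And>z::complex. z \<in> cball 0 (1/2) \<Longrightarrow> norm (ln_Gamma (z + 1)) \<le> K"
      unfolding bounded_iff ball_simps by blast
    thus ?thesis using that[of K] by simp
  qed
  define r where "r = max (norm z) (norm z')"
  define q where "q = min (norm z) (norm z')"
  define \<delta> where "\<delta> = norm (z - z')"
  define \<beta> where "\<beta> = \<bar>ln a\<bar>"
  have q: "q > 0" using z z' by (auto simp: q_def)
  have C'0: "C' \<ge> 0" using C'[of 0] by (auto intro: order.trans[OF norm_ge_zero])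
  \<comment> \<open>The first term is for the outer side, of radius \<open>\<rho> n\<close>, the
    second for the inner side, of radius \<open>1 / \<rho> n\<close>, where \<open>q > 0\<close>
    keeps both points away. Both tend to 0 only through \<open>ln (\<rho> n)\<close>.\<close>
  define B where "B n = C * (\<rho> n)\<^sup>2 / (ln (\<rho> n) - \<beta>) * (\<delta> / (\<rho> n - r)\<^sup>2)
      + C' / (ln (\<rho> n) - \<beta>) * (\<delta> / (q - 1 / \<rho> n)\<^sup>2)" for n
  have B_lim: "(\<lambda>n. 2 * B n) \<longlonglongrightarrow> 0"
    unfolding B_def \<rho>_def using q by real_asymp
  define S where "S \<zeta> n = (LINT t:{exp (- ln (\<rho> n))..exp (ln (\<rho> n))}|lborel. F_integrand a \<zeta> t)" for \<zeta> n
  have "eventually (\<lambda>n. norm ((F_minus_pole a z + S z n) - (F_minus_pole a z' + S z' n)) \<le> 2 * B n) sequentially"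
  proof -
    have "eventually (\<lambda>n. ln (\<rho> n) > \<bar>Re (Ln z)\<bar>) sequentially" "eventually (\<lambda>n. ln (\<rho> n) > \<bar>Re (Ln z')\<bar>) sequentially"
      "eventually (\<lambda>n. ln (\<rho> n) > \<beta>) sequentially" "eventually (\<lambda>n. \<rho> n > r) sequentially"
      "eventually (\<lambda>n. 1 / \<rho> n < q) sequentially" "eventually (\<lambda>n. 1 / \<rho> n < 1 / 2) sequentially"
      unfolding \<rho>_def using q by real_asymp+
    thus ?thesis
    proof eventually_elim
      case (elim n)
      have L0: "ln (\<rho> n) - \<beta> > 0" using elim by simp
      show ?case unfolding S_def
      proof (rule F_minus_pole_difference_bound[OF a z z'])
        fix w assume w: "\<bar>Re w\<bar> = ln (\<rho> n)" "\<bar>Im w\<bar> < pi"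
        show "norm (strip_kernel a z w - strip_kernel a z' w) \<le> B n"
        proof (cases "Re w \<ge> 0")
          case True
          have nw: "norm (exp w) = \<rho> n" using w True \<rho>0[of n] by simp
          have "norm (strip_kernel a z w - strip_kernel a z' w) \<le> C * (\<rho> n)\<^sup>2 / (ln (\<rho> n) - \<beta>) * (\<delta> / (\<rho> n - r)\<^sup>2)"
            unfolding \<beta>_def \<delta>_def
          proof (rule strip_kernel_difference_bound[OF _ w(1)])
            show "norm (ln_Gamma (exp w + 1)) \<le> C * (\<rho> n)\<^sup>2"
              using C(2)[OF exp_in_slit_plane[OF w(2)] nw] nw by simp
            show "\<rho> n - r \<le> norm (exp w - z)" "\<rho> n - r \<le> norm (exp w - z')"
              using norm_triangle_ineq2[of "exp w" z] norm_triangle_ineq2[of "exp w" z'] nw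
              by (auto simp: r_def)
          qed (use elim in \<open>auto simp: \<beta>_def\<close>)
          moreover have "0 \<le> C' / (ln (\<rho> n) - \<beta>) * (\<delta> / (q - 1 / \<rho> n)\<^sup>2)"
            using L0 C'0 by (intro mult_nonneg_nonneg divide_nonneg_nonneg) (auto simp: \<delta>_def)
          ultimately show ?thesis unfolding B_def by linarith
        next
          case False
          have "Re w = - ln (\<rho> n)" using w(1) False by linarith
          hence nw: "norm (exp w) = 1 / \<rho> n" using \<rho>0[of n] by (simp add: exp_minus inverse_eq_divide)
          have "norm (strip_kernel a z w - strip_kernel a z' w) \<le> C' / (ln (\<rho> n) - \<beta>) * (\<delta> / (q - 1 / \<rho> n)\<^sup>2)"
            unfolding \<beta>_def \<delta>_def
          proof (rule strip_kernel_difference_bound[OF _ w(1)])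
            show "norm (ln_Gamma (exp w + 1)) \<le> C'" using C' nw elim by simp
            show "q - 1 / \<rho> n \<le> norm (exp w - z)" "q - 1 / \<rho> n \<le> norm (exp w - z')"
              using norm_triangle_ineq2[of z "exp w"] norm_triangle_ineq2[of z' "exp w"] nw
              by (auto simp: q_def norm_minus_commute)
          qed (use elim in \<open>auto simp: \<beta>_def\<close>)
          moreover have "0 \<le> C * (\<rho> n)\<^sup>2 / (ln (\<rho> n) - \<beta>) * (\<delta> / (\<rho> n - r)\<^sup>2)"
            using L0 C(1) by (intro mult_nonneg_nonneg divide_nonneg_nonneg) (auto simp: \<delta>_def)
          ultimately show ?thesis unfolding B_def by linarith
        qed
      qed (use elim in \<open>auto simp: \<beta>_def\<close>)
    qed
  qed
  hence "(\<lambda>n. (F_minus_pole a z + S z n) - (F_minus_pole a z' + S z' n)) \<longlonglongrightarrow> 0"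
    by (rule Lim_null_comparison[OF _ B_lim])
  moreover have S_lim: "S \<zeta> \<longlonglongrightarrow> (LINT t:{0..}|lborel. F_integrand a \<zeta> t)" if "\<zeta> \<in> slit_plane" for \<zeta>
    unfolding S_def set_lebesgue_integral_def
  proof (rule integral_dominated_convergence[where w = "\<lambda>t. norm (indicator {0..} t *\<^sub>R F_integrand a \<zeta> t)"])
    show "integrable lborel (\<lambda>t. norm (indicat_real {0..} t *\<^sub>R F_integrand a \<zeta> t))"
      using set_integrable_F_integrand[OF a that] unfolding set_integrable_def by (rule integrable_norm)
    show "AE t in lborel. norm (indicat_real {exp (- ln (\<rho> n))..exp (ln (\<rho> n))} t *\<^sub>R F_integrand a \<zeta> t)
        \<le> norm (indicat_real {0..} t *\<^sub>R F_integrand a \<zeta> t)" for n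
    proof (intro AE_I2)
      fix t :: real
      have "t \<in> {exp (- ln (\<rho> n))..exp (ln (\<rho> n))} \<Longrightarrow> t \<ge> 0"
        by (meson atLeastAtMost_iff exp_ge_zero order.trans)
      thus "norm (indicat_real {exp (- ln (\<rho> n))..exp (ln (\<rho> n))} t *\<^sub>R F_integrand a \<zeta> t)
        \<le> norm (indicat_real {0..} t *\<^sub>R F_integrand a \<zeta> t)"
        by (auto simp: indicator_def)
    qed
    show "AE t in lborel. (\<lambda>n. indicat_real {exp (- ln (\<rho> n))..exp (ln (\<rho> n))} t *\<^sub>R F_integrand a \<zeta> t)
        \<longlonglongrightarrow> indicat_real {0..} t *\<^sub>R F_integrand a \<zeta> t"
    proof (intro AE_I2 tendsto_eventually)
      fix t :: real
      consider "t < 0" | "t = 0" | "t > 0" by linarith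
      thus "eventually (\<lambda>n. indicat_real {exp (- ln (\<rho> n))..exp (ln (\<rho> n))} t *\<^sub>R F_integrand a \<zeta> t
          = indicat_real {0..} t *\<^sub>R F_integrand a \<zeta> t) sequentially"
      proof cases
        case 1
        hence "\<not> exp (- ln (\<rho> n)) \<le> t" for n using exp_gt_zero[of "- ln (\<rho> n)"] by linarith
        thus ?thesis using 1 by simp
      next
        case 2
        \<comment> \<open>0 belongs to none of the truncated intervals; the integrand is 0 there
          because \<open>d a 0 = 0\<close>.\<close>
        thus ?thesis by (simp add: d_def)
      next
        case 3
        have "eventually (\<lambda>n. exp (- ln (\<rho> n)) \<le> t) sequentially" "eventually (\<lambda>n. t \<le> exp (ln (\<rho> n))) sequentially"
          unfolding \<rho>_def using 3 by real_asymp+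
        thus ?thesis by eventually_elim (use 3 in auto)
      qed
    qed
  qed measurable
  have "(\<lambda>n. (F_minus_pole a z + S z n) - (F_minus_pole a z' + S z' n)) \<longlonglongrightarrow>
      (F_minus_pole a z + (LINT t:{0..}|lborel. F_integrand a z t)) - (F_minus_pole a z' + (LINT t:{0..}|lborel. F_integrand a z' t))"
    using z z' by (intro tendsto_intros S_lim)
  ultimately have "(F_minus_pole a z + (LINT t:{0..}|lborel. F_integrand a z t)) - (F_minus_pole a z' + (LINT t:{0..}|lborel. F_integrand a z' t)) = 0"
    using LIMSEQ_unique by blast
  thus ?thesis by simp
qed

section \<open>The value of the constant\<close>

lemma ln_fact_asymptotics: "(\<lambda>n. ln (fact n) / (real n * (ln (real n) + c))) \<longlonglongrightarrow> 1"
proof (rule tendsto_sandwich)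
  have ev: "eventually (\<lambda>n. n > 0 \<and> real n * (ln (real n) + c) > 0) sequentially"
    by (intro eventually_conj eventually_gt_at_top) real_asymp
  show "eventually (\<lambda>n. (real n * ln (real n) - real n) / (real n * (ln (real n) + c))
          \<le> ln (fact n) / (real n * (ln (real n) + c))) sequentially"
    using ev
  proof eventually_elim
    case (elim n)
    \<comment> \<open>One term of the exponential series bounds \<open>n!\<close> below by
      \<open>(n / e)^n\<close>; with \<open>n! \<le> n^n\<close> this fixes the leading order
      \<open>n * ln n\<close>.\<close>
    have "real n ^ n / fact n \<le> exp (real n)"
      using sum_le_suminf[OF summable_exp_generic[of "real n"], of "{n}"]
      by (simp add: exp_def scaleR_conv_of_real divide_inverse mult_ac)
    hence "ln (real n ^ n / fact n) \<le> ln (exp (real n))"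
      using elim by (intro ln_mono) auto
    hence "real n * ln (real n) - real n \<le> ln (fact n)"
      using elim by (simp add: ln_div ln_realpow)
    thus ?case using elim by (intro divide_right_mono) auto
  qed
  show "eventually (\<lambda>n. ln (fact n) / (real n * (ln (real n) + c))
          \<le> (real n * ln (real n)) / (real n * (ln (real n) + c))) sequentially"
    using ev
  proof eventually_elim
    case (elim n)
    have "(fact n :: real) \<le> real n ^ n" using fact_le_power[of n, where 'a = real] by simp
    hence "ln (fact n) \<le> ln (real n ^ n)" by (intro ln_mono) auto
    hence "ln (fact n) \<le> real n * ln (real n)" using elim by (simp add: ln_realpow)
    thus ?case using elim by (intro divide_right_mono) auto
  qed
qed real_asymp+

lemma F_of_nat:
  assumes a: "a > 0" and n: "real n > 1 / a"
  shows "F a (of_nat n) = of_real (ln (fact n) / (real n * (ln (real n) + ln a)))"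
proof -
  have n0: "n > 0" using a n by (intro Nat.gr0I) auto
  have slit: "of_nat n \<in> slit_plane" using n0 by (auto simp: complex_nonpos_Reals_iff)
  have "complex_of_nat n \<noteq> of_real (1 / a)" using n by (metis less_irrefl of_real_eq_iff of_real_of_nat_eq)
  hence "F a (of_nat n) = ln_Gamma (of_nat n + 1) / (of_nat n * (Ln (of_nat n) + of_real (ln a)))"
    by (rule F_eq[OF a slit])
  also have "ln_Gamma (of_nat n + 1 :: complex) = of_real (ln (fact n))"
    using ln_Gamma_complex_conv_fact[of "Suc n"] Ln_of_real[of "fact n"] by (simp add: add.commute)
  also have "Ln (of_nat n) = of_real (ln (real n))" using Ln_of_real[of "real n"] n0 by simp
  finally show ?thesis by simp
qed

text \<open>Starting at \<open>Suc n\<close> makes \<open>1 / (1 + t)\<close> dominate every kernel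
  of the sequence.\<close>

lemma integral_F_integrand_tendsto_0:
  assumes a: "a > 0"
  shows "(\<lambda>n. LINT t:{0..}|lborel. F_integrand a (of_nat (Suc n)) t) \<longlonglongrightarrow> 0"
proof -
  have "(\<lambda>n. LINT t:{0..}|lborel. F_integrand a (of_nat (Suc n)) t) \<longlonglongrightarrow> integral\<^sup>L lborel (\<lambda>t::real. 0::complex)"
    unfolding set_lebesgue_integral_def
  proof (rule integral_dominated_convergence[where w = "\<lambda>t. norm (indicator {0..} t *\<^sub>R (dr a t / (1 + t)))"])
    show "integrable lborel (\<lambda>t. norm (indicat_real {0..} t *\<^sub>R (dr a t / (1 + t))))"
      using set_integrable_dr[OF a] unfolding set_integrable_def by (rule integrable_norm)
    show "AE t in lborel. norm (indicat_real {0..} t *\<^sub>R F_integrand a (of_nat (Suc n)) t)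
        \<le> norm (indicat_real {0..} t *\<^sub>R (dr a t / (1 + t)))" for n
    proof (intro AE_I2)
      fix t :: real
      show "norm (indicat_real {0..} t *\<^sub>R F_integrand a (of_nat (Suc n)) t)
        \<le> norm (indicat_real {0..} t *\<^sub>R (dr a t / (1 + t)))"
      proof (cases "t \<ge> 0")
        case True
        have "complex_of_nat (Suc n) + of_real t = of_real (real (Suc n) + t)" by simp
        moreover have "\<bar>real (Suc n) + t\<bar> = real (Suc n) + t" using True by simp
        ultimately have "norm (complex_of_nat (Suc n) + of_real t) = real (Suc n) + t"
          by (simp only: norm_of_real)
        moreover have le: "norm r / (real (Suc n) + t) \<le> norm r / (1 + t)" for r :: real
          using True by (intro divide_left_mono) auto
        ultimately have "norm (F_integrand a (of_nat (Suc n)) t) \<le> norm (dr a t) / (1 + t)"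
          unfolding norm_divide norm_of_real real_norm_def by (simp only: le)
        thus ?thesis using True by simp
      qed simp
    qed
    show "AE t in lborel. (\<lambda>n. indicat_real {0..} t *\<^sub>R F_integrand a (of_nat (Suc n)) t) \<longlonglongrightarrow> 0"
    proof (intro AE_I2)
      fix t :: real
      have "(\<lambda>n. dr a t / (real (Suc n) + t)) \<longlonglongrightarrow> 0" by real_asymp
      hence "(\<lambda>n. complex_of_real (dr a t / (real (Suc n) + t))) \<longlonglongrightarrow> of_real 0" by (rule tendsto_of_real)
      hence "(\<lambda>n. F_integrand a (of_nat (Suc n)) t) \<longlonglongrightarrow> 0" by simp
      from tendsto_scaleR[OF tendsto_const this, of "indicat_real {0..} t"]
      show "(\<lambda>n. indicat_real {0..} t *\<^sub>R F_integrand a (of_nat (Suc n)) t) \<longlonglongrightarrow> 0" by simp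
    qed
  qed measurable
  thus ?thesis by simp
qed

lemma F_representation:
  assumes a: "a > 0" and z: "z \<in> slit_plane" "z \<noteq> of_real (1 / a)"
  shows "F a z = 1 + of_real (ln (Gamma (1 + 1 / a))) / (z - of_real (1 / a))
          - (LINT t:{0..}|lborel. F_integrand a z t)"
proof -
  define S where "S \<zeta> = (LINT t:{0..}|lborel. F_integrand a \<zeta> t)" for \<zeta>
  define c where "c = complex_of_real (ln (Gamma (1 + 1 / a)))"
  have ev: "eventually (\<lambda>n. real (Suc n) > 1 / a) sequentially" by real_asymp
  have "(\<lambda>n. complex_of_real (ln (fact (Suc n)) / (real (Suc n) * (ln (real (Suc n)) + ln a)))) \<longlonglongrightarrow> of_real 1"
    by (intro tendsto_of_real LIMSEQ_Suc ln_fact_asymptotics)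
  moreover have "(\<lambda>n. complex_of_real (ln (Gamma (1 + 1 / a)) / (real (Suc n) - 1 / a))) \<longlonglongrightarrow> of_real 0"
    by (intro tendsto_of_real) real_asymp
  ultimately have "(\<lambda>n. complex_of_real (ln (fact (Suc n)) / (real (Suc n) * (ln (real (Suc n)) + ln a)))
      - complex_of_real (ln (Gamma (1 + 1 / a)) / (real (Suc n) - 1 / a)) + S (of_nat (Suc n))) \<longlonglongrightarrow> of_real 1 - of_real 0 + 0"
    unfolding S_def by (intro tendsto_add tendsto_diff integral_F_integrand_tendsto_0 a)
  moreover have "eventually (\<lambda>n. complex_of_real (ln (fact (Suc n)) / (real (Suc n) * (ln (real (Suc n)) + ln a)))
      - complex_of_real (ln (Gamma (1 + 1 / a)) / (real (Suc n) - 1 / a)) + S (of_nat (Suc n)) = F_minus_pole a z + S z) sequentially"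
    using ev
  proof eventually_elim
    case (elim n)
    have "complex_of_nat (Suc n) \<noteq> of_real (1 / a)" using elim by (metis less_irrefl of_real_eq_iff of_real_of_nat_eq)
    moreover have "complex_of_nat (Suc n) \<in> slit_plane" by (auto simp: complex_nonpos_Reals_iff)
    ultimately have "F_minus_pole a z + S z = F_minus_pole a (of_nat (Suc n)) + S (of_nat (Suc n))"
      unfolding S_def by (intro F_minus_pole_plus_integral_constant a z)
    also have "F_minus_pole a (of_nat (Suc n)) = complex_of_real (ln (fact (Suc n)) / (real (Suc n) * (ln (real (Suc n)) + ln a)))
      - complex_of_real (ln (Gamma (1 + 1 / a)) / (real (Suc n) - 1 / a))"
      unfolding F_minus_pole_def F_of_nat[OF a elim] by simp
    finally show ?case by simp
  qed
  ultimately have "(\<lambda>n. F_minus_pole a z + S z) \<longlonglongrightarrow> of_real 1 - of_real 0 + 0"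
    by (rule Lim_transform_eventually)
  hence "F_minus_pole a z + S z = 1" by (simp add: LIMSEQ_const_iff)
  thus ?thesis by (simp add: F_minus_pole_def S_def algebra_simps)
qed

text \<open>\<open>1 / (z + t)\<close> and \<open>1 / (z - 1 / a)\<close> map the upper half-plane
  to the lower one. The integral enters with a minus sign and has \<open>d a t \<ge> 0\<close>; the
  pole term has the right sign because \<open>1 + 1 / a\<close> lies in (1, 2], where the logarithm
  of Gamma is nonpositive.\<close>

lemma pick_function_F:
  assumes a: "a \<ge> 1"
  shows "pick_function (F a)"
  unfolding pick_function_def
proof (intro conjI allI impI)
  have a0: "a > 0" using a by simp
  have slit: "z \<in> slit_plane" "z \<noteq> of_real (1 / a)" if "Im z > 0" for z
    using that in_slit_plane_if_Im_nonzero[of z] by auto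
  show "F a holomorphic_on {z. Im z > 0}"
  proof -
    have "(\<lambda>z. ln_Gamma (z + 1)) holomorphic_on {z. Im z > 0}"
    proof (rule holomorphic_on_compose_gen[of "\<lambda>z. z + 1" _ ln_Gamma slit_plane, unfolded o_def])
      show "ln_Gamma holomorphic_on slit_plane" by (intro holomorphic_ln_Gamma) auto
      show "(\<lambda>z. z + 1) ` {z. Im z > 0} \<subseteq> slit_plane" using in_slit_plane_if_Im_nonzero by auto
    qed (intro holomorphic_intros)
    moreover have "Ln z + of_real (ln a) \<noteq> 0" if "Im z > 0" for z
      using Ln_eq_minus_ln_iff[OF a0 slit(1)[OF that]] slit(2)[OF that] by simp
    ultimately have "(\<lambda>z. ln_Gamma (z + 1) / (z * (Ln z + of_real (ln a)))) holomorphic_on {z. Im z > 0}"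
      using slit(1) by (intro holomorphic_intros) auto
    thus ?thesis
      by (rule holomorphic_transform) (use F_eq[OF a0] slit in auto)
  qed
  fix z :: complex assume y: "Im z > 0"
  note z = slit[OF y]
  have "ln (Gamma (1 + 1 / a)) \<le> 0" using a by (intro ln_Gamma_between_1_2) auto
  hence "Im (of_real (ln (Gamma (1 + 1 / a))) / (z - of_real (1 / a))) \<ge> 0"
    using y by (simp add: Im_divide divide_nonpos_nonneg mult_nonpos_nonneg)
  moreover have "Im (LINT t:{0..}|lborel. F_integrand a z t) \<le> 0"
  proof -
    have "Im (LINT t:{0..}|lborel. F_integrand a z t) = (\<integral>t. Im (indicat_real {0..} t *\<^sub>R F_integrand a z t) \<partial>lborel)"
      using set_integrable_F_integrand[OF a0 z(1)] unfolding set_lebesgue_integral_def set_integrable_def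
      by (rule integral_Im[symmetric])
    also have "\<dots> = - (\<integral>t. - Im (indicat_real {0..} t *\<^sub>R F_integrand a z t) \<partial>lborel)"
      by simp
    also have "\<dots> \<le> 0"
    proof (subst neg_le_0_iff_le, rule Bochner_Integration.integral_nonneg)
      fix t :: real
      have "dr a t \<ge> 0" if "t \<ge> 0" using d_nonneg[of a t] a that by (intro real_of_ereal_pos) auto
      thus "0 \<le> - Im (indicat_real {0..} t *\<^sub>R F_integrand a z t)"
        using y by (auto simp: indicator_def Im_divide)
    qed
    finally show ?thesis .
  qed
  ultimately show "Im (F a z) \<ge> 0" unfolding F_representation[OF a0 z] by simp
qed

text \<open>Now \<open>1 + 1 / a > 2\<close>, so the pole coefficient is positive and the imaginary
  part tends to minus infinity straight above the pole. This is expressed by a finite limit, that of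
  \<open>F a (z n)\<close> times \<open>z n - 1 / a\<close>.\<close>

lemma not_pick_function_F:
  assumes a: "0 < a" "a < 1"
  shows "\<not> pick_function (F a)"
proof
  assume pick: "pick_function (F a)"
  define p where "p = 1 / a"
  have p: "p > 1" using a by (simp add: p_def)
  define e where "e n = 1 / real (Suc n)" for n
  have e: "e n > 0" "e \<longlonglongrightarrow> 0" for n unfolding e_def by (simp, real_asymp)
  define z where "z n = complex_of_real p + \<i> * of_real (e n)" for n
  have Im_z: "Im (z n) > 0" for n using e(1) by (simp add: z_def)
  have z_slit: "z n \<in> slit_plane" for n by (rule in_slit_plane_if_Im_nonzero) (use Im_z[of n] in auto)
  have p_slit: "complex_of_real p \<in> slit_plane" using p by (auto simp: complex_nonpos_Reals_iff)
  have z_ne: "z n \<noteq> of_real p" for n using e(1)[of n] by (simp add: z_def)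
  have z_lim: "z \<longlonglongrightarrow> of_real p"
  proof -
    have "(\<lambda>n. complex_of_real p + \<i> * of_real (e n)) \<longlonglongrightarrow> of_real p + \<i> * of_real 0"
      by (intro tendsto_intros e)
    thus ?thesis by (simp add: z_def[abs_def])
  qed
  hence z_at: "filterlim z (at (of_real p)) sequentially"
    using z_ne by (intro filterlim_atI) auto
  \<comment> \<open>Since \<open>ln a = - ln p\<close>, the logarithm in the denominator of
    \<open>F\<close> is a difference of \<open>Ln\<close> at two points; its difference quotient
    tends to \<open>1 / p\<close>, which cancels the limit of the factor \<open>z n\<close>.\<close>
  have "((\<lambda>w. (Ln w - Ln (of_real p)) / (w - of_real p)) \<longlongrightarrow> inverse (of_real p)) (at (of_real p))"
    using has_field_derivative_Ln[of "of_real p"] p_slit by (simp add: has_field_derivative_iff)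
  from filterlim_compose[OF this z_at]
  have L: "(\<lambda>n. (Ln (z n) - Ln (of_real p)) / (z n - of_real p)) \<longlonglongrightarrow> inverse (of_real p)" .
  have p1: "complex_of_real p + 1 \<notin> \<real>\<^sub>\<le>\<^sub>0" using p by (auto simp: complex_nonpos_Reals_iff)
  have G: "(\<lambda>n. ln_Gamma (z n + 1)) \<longlonglongrightarrow> ln_Gamma (of_real p + 1)"
    by (rule isCont_tendsto_compose[of _ ln_Gamma, OF isCont_ln_Gamma_complex[OF continuous_ident]])
       (use p1 in \<open>auto intro!: tendsto_intros z_lim\<close>)
  have "(\<lambda>n. ln_Gamma (z n + 1) / (z n * ((Ln (z n) - Ln (of_real p)) / (z n - of_real p))))
      \<longlonglongrightarrow> ln_Gamma (of_real p + 1) / (of_real p * inverse (of_real p))"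
    using p by (intro tendsto_intros G z_lim L) auto
  also have "ln_Gamma (of_real p + 1) / (of_real p * inverse (of_real p)) = complex_of_real (ln (Gamma (p + 1)))"
    using p ln_Gamma_complex_of_real[of "p + 1"] by (simp add: ln_Gamma_real_pos)
  also have "(\<lambda>n. ln_Gamma (z n + 1) / (z n * ((Ln (z n) - Ln (of_real p)) / (z n - of_real p))))
     = (\<lambda>n. F a (z n) * (\<i> * of_real (e n)))"
  proof
    fix n
    have "Ln (of_real p) = - complex_of_real (ln a)"
      using a Ln_of_real[of p] p by (simp add: p_def ln_div)
    moreover have "z n - of_real p = \<i> * of_real (e n)" by (simp add: z_def)
    ultimately show "ln_Gamma (z n + 1) / (z n * ((Ln (z n) - Ln (of_real p)) / (z n - of_real p)))
        = F a (z n) * (\<i> * of_real (e n))"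
      using F_eq[OF a(1) z_slit z_ne[unfolded p_def], of n] by simp
  qed
  finally have "(\<lambda>n. Re (F a (z n) * (\<i> * of_real (e n)))) \<longlonglongrightarrow> Re (complex_of_real (ln (Gamma (p + 1))))"
    by (rule tendsto_Re)
  \<comment> \<open>Multiplication by \<open>\<i> * e n\<close> turns the imaginary part into the
    real part, with a minus sign.\<close>
  moreover have "Re (F a (z n) * (\<i> * of_real (e n))) \<le> 0" for n
  proof -
    have "Im (F a (z n)) \<ge> 0" using pick Im_z[of n] by (simp add: pick_function_def)
    thus ?thesis using e(1)[of n] by (simp add: mult_nonneg_nonneg)
  qed
  ultimately have "Re (complex_of_real (ln (Gamma (p + 1)))) \<le> 0"
    by (intro LIMSEQ_le_const2[of _ _ 0]) auto
  moreover have "Gamma 2 < Gamma (p + 1)" using p by (intro Gamma_real_strict_mono) auto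
  ultimately show False by (simp add: Gamma_numeral)
qed

text \<open>Integrability is asserted next to the formula, since the integral of a non-integrable
  function is 0 by convention and the equation alone would not say that the integral
  converges.\<close>

theorem theorem1p1:
  fixes a :: real
  assumes "a > 0"
  shows "(\<forall>z \<in> slit_plane - {of_real (1 / a)}.
            set_integrable lborel {0..} (F_integrand a z) \<and>
            F a z = 1 + of_real (ln (Gamma (1 + 1 / a))) / (z - of_real (1 / a))
                      - set_lebesgue_integral lborel {0..} (F_integrand a z))
       \<and> (a \<ge> 1/2 \<longrightarrow> (\<forall>t\<ge>0. d a t \<ge> 0))
       \<and> (a \<ge> 1 \<longrightarrow> pick_function (F a))
       \<and> (a < 1 \<longrightarrow> \<not> pick_function (F a))"
  using F_representation[OF assms] set_integrable_F_integrand[OF assms] d_nonneg[of a]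
    pick_function_F[of a] not_pick_function_F[OF assms]
  by blast

end
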